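(* Let $C$ be an $n\times n$ matrix of non-negative integers, and let $m\neq n$. Suppose: - all entries in the first $m$ rows of $C$ are non-zero; - all entries in the last $n-m$ rows of $C$ are zero; - the first column of $C$ is $(d,\dots,d,0,\dots,0)^T$, with $m$ entries equal to $d$, where $d$ is the gcd of the non-zero entries of $C$. Let $d_1,\dots,d_k$ be the non-zero elementary divisors of the $m\times n$ matrix formed by the first $m$ rows of $C$, ordered so that $d_i\mid d_{i+1}$. Let $B=(b_{il})$ be the $n\times n$ matrix defined as follows: - row $1$: $b_{1l}=0$ for $l\le k-1$ and $b_{1l}=d_k$ for $k\le l\le n$; - for $2\le i\le k$: $b_{i,i-1}=d_{i-1}$ and all other entries of row $i$ are $0$; - for $k+1\le i\le m$: $b_{il}=0$ for $l\le k-1$ and $b_{il}=d_k$ for $k\le l\le n$; - rows $m+1,\dots,n$ are zero. If the top-left $m\times m$ corner of $C$ has determinant $0$, then $J_{nm}+C\sim_M J_{nm}+B$.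
   Context: $J_{nm}$ ($0\le m\le n$) is the $n\times n$ matrix whose $i$-th row, for $i\le m$, has a $1$ in position $i$ and $0$ elsewhere, and whose last $n-m$ rows consist entirely of $\infty$. Arithmetic convention: $\infty+a=\infty$. For an $X\times X$ matrix $A$ with entries in $\{0,1,2,\dots\}\cup\{\infty\}$, $G_A$ is the graph with vertex set $X$ and exactly $A(x,y)$ edges from $x$ to $y$. For matrices, $A\sim_M B$ means $G_A\sim_M G_B$. A graph may have multiple edges and loops. A source receives no edges, a sink emits no edges, and an infinite emitter emits infinitely many edges. A vertex is singular if it is a sink or infinite emitter, and regular otherwise. Move-equivalence $\sim_M$ is the smallest equivalence relation on graphs with finitely many vertices such that $G\sim_M E$ whenever $E$ is isomorphic to a graph obtained from $G$ by one of the following moves. (S) Delete a regular source together with the edges it emits. (R) For a regular vertex $u$ emitting exactly one edge $f$, with $r(f)\neq u$, and all of whose incoming edges have the same source $v$: delete $u$, $f$ and the edges into $u$, and add for each $e\in r^{-1}(u)$ an edge $[ef]$ from $v$ to $r(f)$. (O) Out-splitting at a non-sink $v$ along a partition $\mathcal E_1,\dots,\mathcal E_n$ of $s^{-1}(v)$ with at most one infinite part. Replace $v$ by $v^1,\dots,v^n$. Each edge $e$ into $v$ becomes copies $e^1,\dots,e^n$ with $r(e^i)=v^i$ and source $s(e)$, or source $v^j$ if $s(e)=v$ and $e\in\mathcal E_j$. An edge from $v$ to $w\neq v$ lying in $\mathcal E_i$ gets source $v^i$. (I) In-splitting at a regular non-source $v$ along a partition $\mathcal E_1,\dots,\mathcal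 E_n$ of $r^{-1}(v)$. Replace $v$ by $v^1,\dots,v^n$. Each edge $e$ out of $v$ becomes copies $e^1,\dots,e^n$ with $s(e^i)=v^i$ and range $r(e)$, or range $v^j$ if $r(e)=v$ and $e\in\mathcal E_j$. An edge into $v$ from $w\neq v$ lying in $\mathcal E_i$ gets range $v^i$. *)

theory Defs
  imports "Jordan_Normal_Form.Determinant" "HOL-Library.Extended_Nat"
begin

record ('v,'e) graph =
  verts :: "'v set"
  edges :: "'e set"
  src :: "'e \<Rightarrow> 'v"
  rng :: "'e \<Rightarrow> 'v"

definition wf_graph :: "('v,'e) graph \<Rightarrow> bool" where
  "wf_graph G \<longleftrightarrow> finite (verts G) \<and> src G ` edges G \<subseteq> verts G \<and> rng G ` edges G \<subseteq> verts G"

definition out_edges :: "('v,'e) graph \<Rightarrow> 'v \<Rightarrow> 'e set" where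
  "out_edges G v = {e \<in> edges G. src G e = v}"

definition in_edges :: "('v,'e) graph \<Rightarrow> 'v \<Rightarrow> 'e set" where
  "in_edges G v = {e \<in> edges G. rng G e = v}"

definition regular :: "('v,'e) graph \<Rightarrow> 'v \<Rightarrow> bool" where
  "regular G v \<longleftrightarrow> out_edges G v \<noteq> {} \<and> finite (out_edges G v)"

definition ecount :: "('v,'e) graph \<Rightarrow> 'v \<Rightarrow> 'v \<Rightarrow> enat" where
  "ecount G x y = (let S = {e \<in> edges G. src G e = x \<and> rng G e = y}
                   in if finite S then enat (card S) else \<infinity>)"

definition graph_iso :: "('v,'e) graph \<Rightarrow> ('w,'f) graph \<Rightarrow> bool" where
  "graph_iso G H \<longleftrightarrow> (\<exists>\<phi> \<psi>. bij_betw \<phi> (verts G) (verts H) \<and> bij_betw \<psi> (edges G) (edges H) \<and>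
      (\<forall>e\<in>edges G. src H (\<psi> e) = \<phi> (src G e) \<and> rng H (\<psi> e) = \<phi> (rng G e)))"

text \<open>Graphs used for move equivalence: vertices and edges are natural numbers
  (every graph with countably many edges is isomorphic to one of these).\<close>
type_synonym ngraph = "(nat, nat) graph"

definition move_S :: "ngraph \<Rightarrow> ngraph \<Rightarrow> bool" where
  "move_S G H \<longleftrightarrow> (\<exists>v\<in>verts G. regular G v \<and> in_edges G v = {} \<and>
      H = \<lparr>verts = verts G - {v}, edges = edges G - out_edges G v, src = src G, rng = rng G\<rparr>)"

definition R_result :: "ngraph \<Rightarrow> nat \<Rightarrow> nat \<Rightarrow> nat \<Rightarrow> (nat, nat + nat) graph" where
  "R_result G u f v = \<lparr>verts = verts G - {u},
      edges = Inl ` (edges G - {f} - in_edges G u) \<union> Inr ` in_edges G u,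
      src = (\<lambda>x. case x of Inl e \<Rightarrow> src G e | Inr e \<Rightarrow> v),
      rng = (\<lambda>x. case x of Inl e \<Rightarrow> rng G e | Inr e \<Rightarrow> rng G f)\<rparr>"

definition move_R :: "ngraph \<Rightarrow> (nat, nat + nat) graph \<Rightarrow> bool" where
  "move_R G H \<longleftrightarrow> (\<exists>u\<in>verts G. \<exists>f v. regular G u \<and> out_edges G u = {f} \<and> rng G f \<noteq> u \<and>
      v \<in> verts G \<and> (\<forall>e\<in>in_edges G u. src G e = v) \<and> H = R_result G u f v)"

text \<open>The partition of the edges emitted by v is given by a labelling p into parts 0..<n;
  vertex w \<noteq> v becomes (w,0), v becomes (v,i), i < n; edge e becomes copies (e,i).\<close>

definition O_result :: "ngraph \<Rightarrow> nat \<Rightarrow> nat \<Rightarrow> (nat \<Rightarrow> nat) \<Rightarrow> (nat \<times> nat, nat \<times> nat) graph" where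
  "O_result G v n p = \<lparr>verts = (\<lambda>w. (w,0)) ` (verts G - {v}) \<union> (\<lambda>i. (v,i)) ` {..<n},
      edges = {(e,0) | e. e \<in> edges G \<and> rng G e \<noteq> v} \<union> {(e,i) | e i. e \<in> in_edges G v \<and> i < n},
      src = (\<lambda>(e,i). if src G e = v then (v, p e) else (src G e, 0)),
      rng = (\<lambda>(e,i). if rng G e = v then (v, i) else (rng G e, 0))\<rparr>"

definition move_O :: "ngraph \<Rightarrow> (nat \<times> nat, nat \<times> nat) graph \<Rightarrow> bool" where
  "move_O G H \<longleftrightarrow> (\<exists>v\<in>verts G. \<exists>n p. out_edges G v \<noteq> {} \<and> 1 \<le> n \<and>
      (\<forall>e\<in>out_edges G v. p e < n) \<and>
      (\<forall>i<n. {e\<in>out_edges G v. p e = i} \<noteq> {}) \<and>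
      (\<forall>i<n. \<forall>j<n. infinite {e\<in>out_edges G v. p e = i} \<and> infinite {e\<in>out_edges G v. p e = j} \<longrightarrow> i = j) \<and>
      H = O_result G v n p)"

definition I_result :: "ngraph \<Rightarrow> nat \<Rightarrow> nat \<Rightarrow> (nat \<Rightarrow> nat) \<Rightarrow> (nat \<times> nat, nat \<times> nat) graph" where
  "I_result G v n p = \<lparr>verts = (\<lambda>w. (w,0)) ` (verts G - {v}) \<union> (\<lambda>i. (v,i)) ` {..<n},
      edges = {(e,0) | e. e \<in> edges G \<and> src G e \<noteq> v} \<union> {(e,i) | e i. e \<in> out_edges G v \<and> i < n},
      src = (\<lambda>(e,i). if src G e = v then (v, i) else (src G e, 0)),
      rng = (\<lambda>(e,i). if rng G e = v then (v, p e) else (rng G e, 0))\<rparr>"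

definition move_I :: "ngraph \<Rightarrow> (nat \<times> nat, nat \<times> nat) graph \<Rightarrow> bool" where
  "move_I G H \<longleftrightarrow> (\<exists>v\<in>verts G. \<exists>n p. regular G v \<and> in_edges G v \<noteq> {} \<and> 1 \<le> n \<and>
      (\<forall>e\<in>in_edges G v. p e < n) \<and>
      (\<forall>i<n. {e\<in>in_edges G v. p e = i} \<noteq> {}) \<and>
      H = I_result G v n p)"

definition move_step :: "ngraph \<Rightarrow> ngraph \<Rightarrow> bool" where
  "move_step G E \<longleftrightarrow> wf_graph G \<and> wf_graph E \<and>
     ((\<exists>H. move_S G H \<and> graph_iso E H) \<or> (\<exists>H. move_R G H \<and> graph_iso E H) \<or>
      (\<exists>H. move_O G H \<and> graph_iso E H) \<or> (\<exists>H. move_I G H \<and> graph_iso E H))"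

inductive move_equiv :: "ngraph \<Rightarrow> ngraph \<Rightarrow> bool" where
  meq_refl: "wf_graph G \<Longrightarrow> move_equiv G G"
| meq_step: "move_step G E \<Longrightarrow> move_equiv G E"
| meq_sym: "move_equiv G E \<Longrightarrow> move_equiv E G"
| meq_trans: "move_equiv G E \<Longrightarrow> move_equiv E F \<Longrightarrow> move_equiv G F"

definition graph_of_mat :: "enat mat \<Rightarrow> ngraph \<Rightarrow> bool" where
  "graph_of_mat A G \<longleftrightarrow> wf_graph G \<and> verts G = {..<dim_row A} \<and>
     (\<forall>x<dim_row A. \<forall>y<dim_row A. ecount G x y = A $$ (x,y))"

definition mat_move_equiv :: "enat mat \<Rightarrow> enat mat \<Rightarrow> bool" where
  "mat_move_equiv A B \<longleftrightarrow> (\<exists>G H. graph_of_mat A G \<and> graph_of_mat B H \<and> move_equiv G H)"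

definition J_mat :: "nat \<Rightarrow> nat \<Rightarrow> enat mat" where
  "J_mat n m = mat n n (\<lambda>(i,j). if i < m then (if i = j then 1 else 0) else \<infinity>)"

definition elem_divisors :: "int mat \<Rightarrow> nat list \<Rightarrow> bool" where
  "elem_divisors A ds \<longleftrightarrow> length ds \<le> min (dim_row A) (dim_col A) \<and>
     (\<forall>i<length ds. 0 < ds ! i) \<and> (\<forall>i. Suc i < length ds \<longrightarrow> ds ! i dvd ds ! Suc i) \<and>
     (\<exists>P Q. P \<in> carrier_mat (dim_row A) (dim_row A) \<and> Q \<in> carrier_mat (dim_col A) (dim_col A) \<and>
        invertible_mat P \<and> invertible_mat Q \<and>
        P * A * Q = mat (dim_row A) (dim_col A) (\<lambda>(i,j). if i = j \<and> i < length ds then int (ds ! i) else 0))"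

text \<open>The matrix B of the theorem, written with the paper's 1-based indices b i l.\<close>
definition B_entry :: "nat \<Rightarrow> nat list \<Rightarrow> nat \<Rightarrow> nat \<Rightarrow> nat" where
  "B_entry m ds i l = (let k = length ds; dd = (\<lambda>j. ds ! (j - 1)) in
     if i = 1 then (if l \<le> k - 1 then 0 else dd k)
     else if 2 \<le> i \<and> i \<le> k then (if l = i - 1 then dd (i - 1) else 0)
     else if k + 1 \<le> i \<and> i \<le> m then (if l \<le> k - 1 then 0 else dd k)
     else 0)"

definition B_mat :: "nat \<Rightarrow> nat \<Rightarrow> nat list \<Rightarrow> nat mat" where
  "B_mat n m ds = mat n n (\<lambda>(i,l). B_entry m ds (i + 1) (l + 1))"

end

theory Submission
  imports Defs "Jordan_Normal_Form.Column_Operations" "HOL-Library.Nat_Bijection" "HOL-Library.Countable_Set"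
begin

text \<open>Moves realise addition of rows and columns: if there is an edge from \<open>u\<close> to \<open>v\<close>, splitting off
  that edge and collapsing the new vertex adds row \<open>v\<close> of \<open>A - I\<close> to row \<open>u\<close> (in-splitting, \<open>v\<close> regular),
  respectively column \<open>u\<close> to column \<open>v\<close> (out-splitting, \<open>u\<close> possibly an infinite emitter).
  For a matrix \<open>C > 0\<close> whose first column is constantly the common divisor \<open>d\<close>, only the differences
  of the rows to the first row matter up to these operations, since multiples of the first column can
  be added freely; and every elementary operation on the matrix of differences can be realised
  without losing positivity, once the first row is large. So \<open>C\<close> is determined by the Smith normal
  form. The matrix \<open>B\<close> is brought to the same shape explicitly. An infinite emitter supplies more
  columns than rows, which is why no determinant sign survives in the Smith form.\<close>

section \<open>Graphs with prescribed edge counts\<close>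

text \<open>A subtraction is the inverse of an addition and is allowed as soon as its result again
  meets the side conditions. This shapes the argument. The Smith algorithm runs on additions alone:
  subtracting a multiple of a remainder replaces the Euclidean swap, and a pivot gets its sign from
  a second column. It works on differences of rows, whose signs are free, and each of its steps is
  lifted to positive matrices chosen for that step. Moves and integer equivalence are carried
  together in \<open>fun_equiv\<close>, so a matrix reached from \<open>B\<close> by moves has the
  elementary divisors of \<open>B\<close>, and these may be computed with row permutations at the
  integer level. Uniqueness of the diagonal form links the given divisors to those that the
  algorithm produces.\<close>

definition ecard :: "'a set \<Rightarrow> enat" where
  "ecard S = (if finite S then enat (card S) else \<infinity>)"

lemma ecount_ecard: "ecount G x y = ecard {e \<in> edges G. src G e = x \<and> rng G e = y}"
  by (simp add: ecount_def ecard_def)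

lemma ecard_image: "inj_on f S \<Longrightarrow> ecard (f ` S) = ecard S"
  by (simp add: ecard_def finite_image_iff card_image)

lemma ecard_empty [simp]: "ecard {} = 0"
  by (simp add: ecard_def zero_enat_def)

lemma ecard_less [simp]: "ecard {i. enat i < N} = N"
  by (cases N) (simp_all add: ecard_def)

lemma ecard_eq_0_iff: "ecard S = 0 \<longleftrightarrow> S = {}"
  by (auto simp: ecard_def zero_enat_def)

lemma ecard_singleton [simp]: "ecard {a} = 1"
  by (simp add: ecard_def one_enat_def)

lemma ecard_disjoint_union: "A \<inter> B = {} \<Longrightarrow> ecard (A \<union> B) = ecard A + ecard B"
  by (auto simp: ecard_def card_Un_disjoint)

text \<open>Both types are countable, so \<open>\<infinity>\<close> stands for a single cardinality
  and equal counts suffice for a bijection.\<close>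

lemma ecard_eq_bij:
  fixes S :: "'a::countable set" and T :: "'b::countable set"
  assumes "ecard S = ecard T"
  shows "\<exists>f. bij_betw f S T"
proof (cases "finite S")
  case True
  with assms have "finite T" "card S = card T"
    by (auto simp: ecard_def split: if_splits)
  with True show ?thesis by (simp add: finite_same_card_bij)
next
  case False
  with assms have "infinite T" by (auto simp: ecard_def split: if_splits)
  then have "bij_betw (to_nat_on S) S UNIV" "bij_betw (from_nat_into T) UNIV T"
    using False by (auto intro: to_nat_on_infinite bij_betw_from_nat_into)
  then show ?thesis using bij_betw_trans by blast
qed

text \<open>The edge sets between ordered pairs of vertices partition all edges, so bijections
  chosen pair by pair glue to one. Isomorphism claims thereby become equalities of numbers in
  \<open>enat\<close>.\<close>

lemma graph_isoI:
  fixes G :: "('v,'e::countable) graph" and H :: "('w,'f::countable) graph"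
  assumes wG: "wf_graph G" and wH: "wf_graph H"
    and phi: "bij_betw \<phi> (verts G) (verts H)"
    and cnt: "\<And>x y. x \<in> verts G \<Longrightarrow> y \<in> verts G \<Longrightarrow> ecount G x y = ecount H (\<phi> x) (\<phi> y)"
  shows "graph_iso G H"
proof -
  define S where "S x y = {e \<in> edges G. src G e = x \<and> rng G e = y}" for x y
  define T where "T x y = {e \<in> edges H. src H e = x \<and> rng H e = y}" for x y
  have "\<exists>f. x \<in> verts G \<and> y \<in> verts G \<longrightarrow> bij_betw f (S x y) (T (\<phi> x) (\<phi> y))" for x y
    using cnt[of x y] ecard_eq_bij[of "S x y" "T (\<phi> x) (\<phi> y)"]
    unfolding ecount_ecard S_def T_def by blast
  then obtain f where f: "\<And>x y. x \<in> verts G \<Longrightarrow> y \<in> verts G \<Longrightarrow> bij_betw (f x y) (S x y) (T (\<phi> x) (\<phi> y))"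
    by metis
  define \<psi> where "\<psi> e = f (src G e) (rng G e) e" for e
  have vs: "src G e \<in> verts G" "rng G e \<in> verts G" if "e \<in> edges G" for e
    using wG that by (auto simp: wf_graph_def)
  have psiT: "\<psi> e \<in> T (\<phi> (src G e)) (\<phi> (rng G e))" if "e \<in> edges G" for e
  proof -
    have "e \<in> S (src G e) (rng G e)" using that by (simp add: S_def)
    then show ?thesis using f[OF vs[OF that]] unfolding \<psi>_def bij_betw_def by blast
  qed
  have inj: "inj_on \<psi> (edges G)"
  proof (rule inj_onI)
    fix a b assume ab: "a \<in> edges G" "b \<in> edges G" "\<psi> a = \<psi> b"
    have "\<phi> (src G a) = \<phi> (src G b)" "\<phi> (rng G a) = \<phi> (rng G b)"
      using psiT[OF ab(1)] psiT[OF ab(2)] ab(3) by (auto simp: T_def)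
    then have eq: "src G a = src G b" "rng G a = rng G b"
      using phi vs ab by (auto simp: bij_betw_def inj_on_def)
    have "inj_on (f (src G a) (rng G a)) (S (src G a) (rng G a))"
      using f vs ab by (auto simp: bij_betw_def)
    then show "a = b" using ab eq unfolding \<psi>_def S_def inj_on_def by auto
  qed
  have "edges H \<subseteq> \<psi> ` edges G"
  proof
    fix h assume h: "h \<in> edges H"
    then have "src H h \<in> verts H" "rng H h \<in> verts H" using wH by (auto simp: wf_graph_def)
    then obtain x y where xy: "x \<in> verts G" "y \<in> verts G" "src H h = \<phi> x" "rng H h = \<phi> y"
      using phi unfolding bij_betw_def by blast
    then have "h \<in> T (\<phi> x) (\<phi> y)" using h by (simp add: T_def)
    then obtain e where "e \<in> S x y" "h = f x y e" using f[OF xy(1,2)] unfolding bij_betw_def by blast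
    then show "h \<in> \<psi> ` edges G" by (auto simp: S_def \<psi>_def)
  qed
  with inj have "bij_betw \<psi> (edges G) (edges H)"
    using psiT by (auto simp: bij_betw_def T_def)
  moreover have "\<forall>e\<in>edges G. src H (\<psi> e) = \<phi> (src G e) \<and> rng H (\<psi> e) = \<phi> (rng G e)"
    using psiT by (auto simp: T_def)
  ultimately show ?thesis unfolding graph_iso_def using phi by blast
qed

text \<open>Edges of an \<open>ngraph\<close> are natural numbers, so edge number \<open>i\<close>
  from \<open>x\<close> to \<open>y\<close> is coded as one number.\<close>

definition enc :: "nat \<Rightarrow> nat \<Rightarrow> nat \<Rightarrow> nat" where
  "enc x y i = prod_encode (prod_encode (x, y), i)"

definition enc_src :: "nat \<Rightarrow> nat" where "enc_src e = fst (prod_decode (fst (prod_decode e)))"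
definition enc_rng :: "nat \<Rightarrow> nat" where "enc_rng e = snd (prod_decode (fst (prod_decode e)))"
definition enc_idx :: "nat \<Rightarrow> nat" where "enc_idx e = snd (prod_decode e)"

lemma enc_simps [simp]:
  "enc_src (enc x y i) = x" "enc_rng (enc x y i) = y" "enc_idx (enc x y i) = i"
  "enc (enc_src e) (enc_rng e) (enc_idx e) = e"
  by (simp_all add: enc_def enc_src_def enc_rng_def enc_idx_def)

lemma enc_eq_iff: "e = enc x y i \<longleftrightarrow> enc_src e = x \<and> enc_rng e = y \<and> enc_idx e = i"
  by (metis enc_simps)

lemma ecard_enc: "ecard {e. enc_src e = x \<and> enc_rng e = y \<and> P (enc_idx e)} = ecard {i. P i}"
proof -
  have "{e. enc_src e = x \<and> enc_rng e = y \<and> P (enc_idx e)} = enc x y ` {i. P i}"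
    by (auto simp: image_iff enc_eq_iff)
  moreover have "inj_on (enc x y) {i. P i}" by (metis enc_simps(3) inj_onI)
  ultimately show ?thesis by (simp add: ecard_image)
qed

text \<open>The canonical graph with adjacency matrix \<open>A\<close>. \<open>V\<close> is
  arbitrary and \<open>A\<close> a function because auxiliary vertices come and go between
  moves.\<close>

definition mat_graph :: "nat set \<Rightarrow> (nat \<Rightarrow> nat \<Rightarrow> enat) \<Rightarrow> ngraph" where
  "mat_graph V A = \<lparr>verts = V,
     edges = {e. enc_src e \<in> V \<and> enc_rng e \<in> V \<and> enat (enc_idx e) < A (enc_src e) (enc_rng e)},
     src = enc_src, rng = enc_rng\<rparr>"

lemma mat_graph_sel [simp]:
  "verts (mat_graph V A) = V" "src (mat_graph V A) = enc_src" "rng (mat_graph V A) = enc_rng"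
  by (simp_all add: mat_graph_def)

lemma mat_graph_edges:
  "e \<in> edges (mat_graph V A) \<longleftrightarrow> enc_src e \<in> V \<and> enc_rng e \<in> V \<and> enat (enc_idx e) < A (enc_src e) (enc_rng e)"
  by (simp add: mat_graph_def)

lemma enc_in_mat_graph: "enc x y i \<in> edges (mat_graph V A) \<longleftrightarrow> x \<in> V \<and> y \<in> V \<and> enat i < A x y"
  by (simp add: mat_graph_edges)

lemma wf_mat_graph: "finite V \<Longrightarrow> wf_graph (mat_graph V A)"
  by (auto simp: wf_graph_def mat_graph_edges)

lemma ecard_mat_graph:
  assumes "x \<in> V" "y \<in> V"
  shows "ecard {e \<in> edges (mat_graph V A). enc_src e = x \<and> enc_rng e = y \<and> P (enc_idx e)}
     = ecard {i. enat i < A x y \<and> P i}"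
proof -
  have "{e \<in> edges (mat_graph V A). enc_src e = x \<and> enc_rng e = y \<and> P (enc_idx e)}
     = {e. enc_src e = x \<and> enc_rng e = y \<and> enat (enc_idx e) < A x y \<and> P (enc_idx e)}"
    using assms by (auto simp: mat_graph_edges)
  then show ?thesis by (simp add: ecard_enc[where P = "\<lambda>i. enat i < A x y \<and> P i"])
qed

lemma ecount_mat_graph: "x \<in> V \<Longrightarrow> y \<in> V \<Longrightarrow> ecount (mat_graph V A) x y = A x y"
  using ecard_mat_graph[of x V y A "\<lambda>_. True"] by (simp add: ecount_ecard)

lemma mat_graph_cong: "(\<And>x y. x \<in> V \<Longrightarrow> y \<in> V \<Longrightarrow> A x y = A' x y) \<Longrightarrow> mat_graph V A = mat_graph V A'"
  by (auto simp: mat_graph_def)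

lemma finite_out_edges_mat_graph:
  assumes "finite V" "u \<in> V" "\<And>y. y \<in> V \<Longrightarrow> A u y \<noteq> \<infinity>"
  shows "finite (out_edges (mat_graph V A) u)"
proof -
  have "out_edges (mat_graph V A) u \<subseteq> (\<Union>y\<in>V. enc u y ` {i. enat i < A u y})"
    by (force simp: out_edges_def mat_graph_edges image_iff enc_eq_iff)
  moreover have "finite {i. enat i < A u y}" if "y \<in> V" for y
    using assms(3)[OF that] by (cases "A u y") auto
  ultimately show ?thesis using assms(1) by (meson finite_UN_I finite_imageI finite_subset)
qed

lemma nonzero_mat_edge: "A x y \<noteq> 0 \<Longrightarrow> x \<in> V \<Longrightarrow> y \<in> V \<Longrightarrow> enc x y 0 \<in> edges (mat_graph V A)"
  by (simp add: enc_in_mat_graph zero_enat_def[symmetric])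

section \<open>The moves on matrices\<close>

text \<open>Out-splitting distributes row \<open>v\<close> over the parts and repeats column
  \<open>v\<close> for each new vertex. In each case the counted edges are old edges that all carry
  the same copy number.\<close>

lemma ecount_O_result:
  shows "w \<noteq> v \<Longrightarrow> x \<noteq> v \<Longrightarrow> ecount (O_result G v n p) (x, 0) (w, 0) = ecount G x w"
    and "w \<noteq> v \<Longrightarrow> ecount (O_result G v n p) (v, i) (w, 0)
           = ecard {e \<in> edges G. src G e = v \<and> rng G e = w \<and> p e = i}"
    and "x \<noteq> v \<Longrightarrow> j < n \<Longrightarrow> ecount (O_result G v n p) (x, 0) (v, j) = ecount G x v"
    and "j < n \<Longrightarrow> ecount (O_result G v n p) (v, i) (v, j)
           = ecard {e \<in> edges G. src G e = v \<and> rng G e = v \<and> p e = i}"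
proof -
  have inj: "inj_on (\<lambda>e. (e, i)) S" for S :: "nat set" and i :: nat by (auto simp: inj_on_def)
  have *: "ecard T = ecard S" if "T = (\<lambda>e. (e, i)) ` S" for T and S :: "nat set" and i :: nat
    using ecard_image[OF inj] that by simp
  show "w \<noteq> v \<Longrightarrow> x \<noteq> v \<Longrightarrow> ecount (O_result G v n p) (x, 0) (w, 0) = ecount G x w"
    unfolding ecount_ecard by (rule *[where i = 0]) (auto simp: O_result_def in_edges_def image_iff split: if_splits)
  show "w \<noteq> v \<Longrightarrow> ecount (O_result G v n p) (v, i) (w, 0)
           = ecard {e \<in> edges G. src G e = v \<and> rng G e = w \<and> p e = i}"
    unfolding ecount_ecard by (rule *[where i = 0]) (auto simp: O_result_def in_edges_def image_iff split: if_splits)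
  show "x \<noteq> v \<Longrightarrow> j < n \<Longrightarrow> ecount (O_result G v n p) (x, 0) (v, j) = ecount G x v"
    unfolding ecount_ecard by (rule *[where i = j]) (auto simp: O_result_def in_edges_def image_iff split: if_splits)
  show "j < n \<Longrightarrow> ecount (O_result G v n p) (v, i) (v, j)
           = ecard {e \<in> edges G. src G e = v \<and> rng G e = v \<and> p e = i}"
    unfolding ecount_ecard by (rule *[where i = j]) (auto simp: O_result_def in_edges_def image_iff split: if_splits)
qed

text \<open>Dual to out-splitting: column \<open>v\<close> is distributed over the parts, row
  \<open>v\<close> is repeated.\<close>

lemma ecount_I_result:
  shows "w \<noteq> v \<Longrightarrow> x \<noteq> v \<Longrightarrow> ecount (I_result G v n p) (x, 0) (w, 0) = ecount G x w"
    and "x \<noteq> v \<Longrightarrow> ecount (I_result G v n p) (x, 0) (v, i)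
           = ecard {e \<in> edges G. src G e = x \<and> rng G e = v \<and> p e = i}"
    and "w \<noteq> v \<Longrightarrow> j < n \<Longrightarrow> ecount (I_result G v n p) (v, j) (w, 0) = ecount G v w"
    and "j < n \<Longrightarrow> ecount (I_result G v n p) (v, j) (v, i)
           = ecard {e \<in> edges G. src G e = v \<and> rng G e = v \<and> p e = i}"
proof -
  have inj: "inj_on (\<lambda>e. (e, i)) S" for S :: "nat set" and i :: nat by (auto simp: inj_on_def)
  have *: "ecard T = ecard S" if "T = (\<lambda>e. (e, i)) ` S" for T and S :: "nat set" and i :: nat
    using ecard_image[OF inj] that by simp
  show "w \<noteq> v \<Longrightarrow> x \<noteq> v \<Longrightarrow> ecount (I_result G v n p) (x, 0) (w, 0) = ecount G x w"
    unfolding ecount_ecard by (rule *[where i = 0]) (auto simp: I_result_def out_edges_def image_iff split: if_splits)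
  show "x \<noteq> v \<Longrightarrow> ecount (I_result G v n p) (x, 0) (v, i)
           = ecard {e \<in> edges G. src G e = x \<and> rng G e = v \<and> p e = i}"
    unfolding ecount_ecard by (rule *[where i = 0]) (auto simp: I_result_def out_edges_def image_iff split: if_splits)
  show "w \<noteq> v \<Longrightarrow> j < n \<Longrightarrow> ecount (I_result G v n p) (v, j) (w, 0) = ecount G v w"
    unfolding ecount_ecard by (rule *[where i = j]) (auto simp: I_result_def out_edges_def image_iff split: if_splits)
  show "j < n \<Longrightarrow> ecount (I_result G v n p) (v, j) (v, i)
           = ecard {e \<in> edges G. src G e = v \<and> rng G e = v \<and> p e = i}"
    unfolding ecount_ecard by (rule *[where i = j]) (auto simp: I_result_def out_edges_def image_iff split: if_splits)
qed

text \<open>Each edge from \<open>v\<close> into \<open>u\<close> continues in exactly one way, by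
  \<open>f\<close>, so the paths of length two through \<open>u\<close> become edges from
  \<open>v\<close> to \<open>rng G f\<close>.\<close>

lemma ecount_R_result:
  assumes "v \<noteq> u" "rng G f \<noteq> u" "out_edges G u = {f}" "\<forall>e\<in>in_edges G u. src G e = v" "x \<noteq> u" "y \<noteq> u"
  shows "ecount (R_result G u f v) x y = ecount G x y + (if x = v \<and> y = rng G f then ecount G v u else 0)"
proof -
  let ?S = "{e \<in> edges G. src G e = x \<and> rng G e = y}"
  let ?T = "if x = v \<and> y = rng G f then in_edges G u else {}"
  have f: "src G f = u" using assms(3) by (auto simp: out_edges_def)
  have 1: "e \<in> edges G - {f} - in_edges G u \<and> src G e = x \<and> rng G e = y \<longleftrightarrow> e \<in> ?S" for e
    using f assms(5,6) by (auto simp: in_edges_def)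
  have "{e \<in> edges (R_result G u f v). src (R_result G u f v) e = x \<and> rng (R_result G u f v) e = y}
     = Inl ` {e. e \<in> edges G - {f} - in_edges G u \<and> src G e = x \<and> rng G e = y} \<union> Inr ` ?T"
    by (auto simp: R_result_def)
  then have "{e \<in> edges (R_result G u f v). src (R_result G u f v) e = x \<and> rng (R_result G u f v) e = y}
     = Inl ` ?S \<union> Inr ` ?T"
    unfolding 1 by simp
  moreover have "ecard (Inl ` ?S \<union> Inr ` ?T) = ecard ?S + ecard ?T"
    by (subst ecard_disjoint_union) (auto simp: ecard_image)
  moreover have "ecount G v u = ecard (in_edges G u)"
    unfolding ecount_ecard in_edges_def
    by (rule arg_cong[where f = ecard]) (use assms(4) in \<open>auto simp: in_edges_def\<close>)
  ultimately show ?thesis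
    by (simp add: ecount_ecard[of "R_result G u f v"] ecount_ecard[of G x y])
qed

lemma wf_O_result:
  assumes "wf_graph G" "v \<in> verts G" "\<forall>e\<in>out_edges G v. p e < n"
  shows "wf_graph (O_result G v n p)"
proof -
  have "src G e \<in> verts G" "rng G e \<in> verts G" if "e \<in> edges G" for e
    using assms(1) that by (auto simp: wf_graph_def)
  then show ?thesis
    using assms by (fastforce simp: wf_graph_def O_result_def in_edges_def out_edges_def image_iff split: if_splits)
qed

lemma wf_I_result:
  assumes "wf_graph G" "v \<in> verts G" "\<forall>e\<in>in_edges G v. p e < n"
  shows "wf_graph (I_result G v n p)"
proof -
  have "src G e \<in> verts G" "rng G e \<in> verts G" if "e \<in> edges G" for e
    using assms(1) that by (auto simp: wf_graph_def)
  then show ?thesis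
    using assms by (fastforce simp: wf_graph_def I_result_def in_edges_def out_edges_def image_iff split: if_splits)
qed

lemma wf_R_result:
  assumes "wf_graph G" "out_edges G u = {f}" "rng G f \<noteq> u" "v \<in> verts G" "v \<noteq> u"
  shows "wf_graph (R_result G u f v)"
proof -
  have *: "src G e \<in> verts G" "rng G e \<in> verts G" if "e \<in> edges G" for e
    using assms(1) that by (auto simp: wf_graph_def)
  have "f \<in> edges G" using assms(2) by (auto simp: out_edges_def)
  then show ?thesis
    using assms * by (fastforce simp: wf_graph_def R_result_def in_edges_def out_edges_def image_iff)
qed

declare meq_trans [trans]

text \<open>Serves to redirect \<open>c\<close> out of \<open>N\<close> parallel edges. Sizes are
  extended numbers since the source may be an infinite emitter; two infinite parts are the even and
  the odd indices.\<close>

lemma split_index_set: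
  assumes "c + r = N"
  shows "\<exists>S. ecard {i. enat i < N \<and> i \<in> S} = c \<and> ecard {i. enat i < N \<and> i \<notin> S} = r"
proof (cases c)
  case (enat k)
  show ?thesis
  proof (cases r)
    case (enat l)
    with \<open>c = enat k\<close> assms have N: "N = enat (k + l)" by auto
    have "{i. enat i < N \<and> i \<in> {..<k}} = {..<k}" "{i. enat i < N \<and> i \<notin> {..<k}} = {k..<k+l}"
      using N by auto
    then show ?thesis using \<open>c = enat k\<close> enat by (intro exI[of _ "{..<k}"]) (simp add: ecard_def)
  next
    case infinity
    with assms have N: "N = \<infinity>" by (cases c) auto
    have "{i. enat i < N \<and> i \<in> {..<k}} = {..<k}" "{i. enat i < N \<and> i \<notin> {..<k}} = {k..}"
      using N by auto
    then show ?thesis using enat infinity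
      by (intro exI[of _ "{..<k}"]) (simp add: ecard_def infinite_Ici)
  qed
next
  case infinity
  with assms have N: "N = \<infinity>" by (cases r) auto
  show ?thesis
  proof (cases r)
    case (enat l)
    have "{i. enat i < N \<and> i \<in> {l..}} = {l..}" "{i. enat i < N \<and> i \<notin> {l..}} = {..<l}"
      using N by auto
    then show ?thesis using enat infinity
      by (intro exI[of _ "{l..}"]) (simp add: ecard_def infinite_Ici)
  next
    case infinity
    have "{i. enat i < N \<and> i \<in> {i. even i}} = range ((*) 2)" using N by auto
    moreover have "{i. enat i < N \<and> i \<notin> {i. even i}} = range (\<lambda>i. 2 * i + 1)"
      using N by (auto elim!: oddE)
    moreover have "infinite (range ((*) (2::nat)))" "infinite (range (\<lambda>i::nat. 2 * i + 1))"
      by (auto intro!: range_inj_infinite inj_onI)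
    ultimately show ?thesis using \<open>c = \<infinity>\<close> infinity
      by (intro exI[of _ "{i. even i}"]) (simp add: ecard_def)
  qed
qed

section \<open>Splitting and contracting single vertices in terms of adjacency matrices\<close>

lemma move_equiv_O:
  assumes "wf_graph G" "wf_graph E" "move_O G H" "graph_iso E H"
  shows "move_equiv G E"
  using assms by (blast intro: meq_step[unfolded move_step_def])

lemma move_equiv_I:
  assumes "wf_graph G" "wf_graph E" "move_I G H" "graph_iso E H"
  shows "move_equiv G E"
  using assms by (blast intro: meq_step[unfolded move_step_def])

lemma move_equiv_R:
  assumes "wf_graph G" "wf_graph E" "move_R G H" "graph_iso E H"
  shows "move_equiv G E"
  using assms by (blast intro: meq_step[unfolded move_step_def])

lemma bij_betw_split_vertex:
  assumes "u \<in> V" "z \<notin> V"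
  shows "bij_betw (\<lambda>x. if x = z then (u, 1) else (x, 0::nat)) (insert z V)
    ((\<lambda>w. (w,0)) ` (V - {u}) \<union> (\<lambda>i. (u,i)) ` {..<2})"
proof -
  have "{..<2} = {0, 1::nat}" by auto
  then show ?thesis using assms by (auto simp: bij_betw_def inj_on_def image_iff)
qed

text \<open>Out-splitting with one edge from \<open>u\<close> to \<open>v\<close> as a part of its
  own: the new vertex \<open>z\<close> emits just that edge and receives a copy of every edge into
  \<open>u\<close>. That part being a singleton, \<open>u\<close> may be an infinite emitter;
  \<open>other\<close> keeps the second part non-empty.\<close>

lemma outsplit_one_edge:
  assumes fin: "finite V" and uv: "u \<in> V" "v \<in> V" "u \<noteq> v" and z: "z \<notin> V"
    and f: "A u v \<noteq> 0" and other: "2 \<le> A u v \<or> (\<exists>y\<in>V. y \<noteq> v \<and> A u y \<noteq> 0)"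
  shows "move_equiv (mat_graph V A) (mat_graph (insert z V)
    (\<lambda>x y. if x = z then (if y = v then 1 else 0) else if y = z then A x u
           else if x = u \<and> y = v then A u v - 1 else A x y))"
    (is "move_equiv ?G (mat_graph _ ?A')")
proof -
  let ?E = "mat_graph (insert z V) ?A'"
  define p where "p e = (if e = enc u v 0 then 1 else 0::nat)" for e
  let ?H = "O_result ?G u 2 p"
  have f_in: "enc u v 0 \<in> out_edges ?G u"
    using f uv by (simp add: out_edges_def nonzero_mat_edge)
  have nat2: "{..<2} = {0, 1::nat}" by auto
  obtain g where g: "g \<in> out_edges ?G u" "g \<noteq> enc u v 0"
  proof (cases "2 \<le> A u v")
    case True
    then have "enat 1 < A u v" by (cases "A u v") (auto simp: numeral_eq_enat)
    then show ?thesis using that[of "enc u v 1"] uv by (simp add: out_edges_def enc_in_mat_graph enc_eq_iff)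
  next
    case False
    then obtain y where "y \<in> V" "y \<noteq> v" "A u y \<noteq> 0" using other by auto
    then show ?thesis using that[of "enc u y 0"] uv by (simp add: out_edges_def nonzero_mat_edge enc_eq_iff)
  qed
  have parts: "{e \<in> out_edges ?G u. p e = 1} = {enc u v 0}" using f_in by (auto simp: p_def)
  have "move_O ?G ?H"
    unfolding move_O_def
  proof (intro bexI[of _ u] exI[of _ 2] exI[of _ p] conjI)
    show "\<forall>i<2. {e \<in> out_edges ?G u. p e = i} \<noteq> {}"
    proof (intro allI impI)
      fix i :: nat assume "i < 2"
      then consider "i = 0" | "i = 1" by linarith
      then show "{e \<in> out_edges ?G u. p e = i} \<noteq> {}"
        using f_in g by cases (auto simp: p_def)
    qed
    show "\<forall>i<2. \<forall>j<2. infinite {e \<in> out_edges ?G u. p e = i} \<and> infinite {e \<in> out_edges ?G u. p e = j} \<longrightarrow> i = j"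
    proof (intro allI impI)
      fix i j :: nat
      assume ij: "i < 2" "j < 2" "infinite {e \<in> out_edges ?G u. p e = i} \<and> infinite {e \<in> out_edges ?G u. p e = j}"
      then have "i \<noteq> 1" "j \<noteq> 1" using parts by auto
      with ij show "i = j" by linarith
    qed
  qed (use uv f_in in \<open>auto simp: p_def\<close>)
  moreover have "graph_iso ?E ?H"
  proof (rule graph_isoI[where \<phi> = "\<lambda>x. if x = z then (u, 1) else (x, 0)"])
    show "wf_graph ?E" "wf_graph ?H"
      using fin uv by (auto intro!: wf_mat_graph wf_O_result simp: p_def)
    show "bij_betw (\<lambda>x. if x = z then (u, 1) else (x, 0)) (verts ?E) (verts ?H)"
      using bij_betw_split_vertex[OF uv(1) z] by (simp add: O_result_def)
    have cnt: "ecard {e \<in> edges ?G. enc_src e = u \<and> enc_rng e = y \<and> p e = i}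
        = (if i = 0 then if y = v then A u v - 1 else A u y else if y = v then 1 else 0)"
      if y: "y \<in> V" and i: "i < 2" for y i
    proof -
      consider "y = v" "i = 0" | "y = v" "i = 1" | "y \<noteq> v" "i = 0" | "y \<noteq> v" "i = 1" using i by linarith
      then show ?thesis
      proof cases
        case 1
        then have "{e \<in> edges ?G. enc_src e = u \<and> enc_rng e = y \<and> p e = i}
          = {e \<in> edges ?G. enc_src e = u \<and> enc_rng e = v \<and> enc_idx e \<noteq> 0}"
          by (auto simp: p_def enc_eq_iff)
        then have "ecard {e \<in> edges ?G. enc_src e = u \<and> enc_rng e = y \<and> p e = i}
          = ecard {k. enat k < A u v \<and> k \<noteq> 0}"
          using ecard_mat_graph[OF uv(1,2), of A "\<lambda>k. k \<noteq> 0"] by simp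
        also have "{k. enat k < A u v \<and> k \<noteq> 0} = Suc ` {k. enat k < A u v - 1}"
        proof (rule Set.set_eqI)
          fix k
          have "enat (Suc k) < A u v \<longleftrightarrow> enat k < A u v - 1" for k
            by (cases "A u v") (auto simp: one_enat_def)
          then show "k \<in> {k. enat k < A u v \<and> k \<noteq> 0} \<longleftrightarrow> k \<in> Suc ` {k. enat k < A u v - 1}"
            by (cases k) auto
        qed
        also have "ecard (Suc ` {k. enat k < A u v - 1}) = A u v - 1" by (simp add: ecard_image)
        finally show ?thesis using 1 by simp
      next
        case 2
        then have "{e \<in> edges ?G. enc_src e = u \<and> enc_rng e = y \<and> p e = i} = {enc u v 0}"
          using f_in by (auto simp: p_def out_edges_def)
        then show ?thesis using 2 by simp
      next
        case 3
        then have "{e \<in> edges ?G. enc_src e = u \<and> enc_rng e = y \<and> p e = i}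
          = {e \<in> edges ?G. enc_src e = u \<and> enc_rng e = y \<and> True}"
          by (auto simp: p_def enc_eq_iff)
        then show ?thesis using 3 ecard_mat_graph[OF uv(1) y, of A "\<lambda>_. True"] by simp
      next
        case 4
        then have "{e \<in> edges ?G. enc_src e = u \<and> enc_rng e = y \<and> p e = i} = {}"
          by (auto simp: p_def enc_eq_iff)
        then show ?thesis using 4 by (simp del: Collect_empty_eq)
      qed
    qed
    fix x y assume xy: "x \<in> verts ?E" "y \<in> verts ?E"
    have uz: "u \<noteq> z" "v \<noteq> z" using uv z by auto
    have c0: "\<And>w x. w \<noteq> u \<Longrightarrow> x \<noteq> u \<Longrightarrow> x \<in> V \<Longrightarrow> w \<in> V \<Longrightarrow> ecount ?H (x, 0) (w, 0) = A x w"
      using ecount_O_result(1)[of _ u _ ?G] by (simp add: ecount_mat_graph)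
    have c1: "\<And>w i. w \<noteq> u \<Longrightarrow> w \<in> V \<Longrightarrow> i < 2 \<Longrightarrow> ecount ?H (u, i) (w, 0)
       = (if i = 0 then if w = v then A u v - 1 else A u w else if w = v then 1 else 0)"
      using ecount_O_result(2)[of _ u ?G] cnt by simp
    have c2: "\<And>x j. x \<noteq> u \<Longrightarrow> x \<in> V \<Longrightarrow> j < 2 \<Longrightarrow> ecount ?H (x, 0) (u, j) = A x u"
      using ecount_O_result(3)[of _ u _ _ ?G] uv by (simp add: ecount_mat_graph)
    have c3: "\<And>i j. i < 2 \<Longrightarrow> j < 2 \<Longrightarrow> ecount ?H (u, i) (u, j) = (if i = 0 then A u u else 0)"
      using ecount_O_result(4)[of _ _ ?G u] cnt[OF uv(1)] uv by simp
    have e: "ecount ?E x y = ?A' x y" using xy by (simp add: ecount_mat_graph)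
    show "ecount ?E x y = ecount ?H (if x = z then (u, 1) else (x, 0)) (if y = z then (u, 1) else (y, 0))"
      unfolding e using xy uz uv(3) z
      by (cases "x = z"; cases "y = z"; cases "x = u"; cases "y = u"; simp add: c0 c1 c2 c3 flip: One_nat_def)
  qed
  ultimately show ?thesis using move_equiv_O[OF wf_mat_graph wf_mat_graph] fin by blast
qed

text \<open>In-splitting along \<open>c\<close> of the parallel edges from \<open>w\<close> to
  \<open>v\<close>: the new vertex \<open>z\<close> receives just these and repeats row
  \<open>v\<close>. The move asks for a regular \<open>v\<close>, hence \<open>row\<close> and
  \<open>emits\<close>.\<close>

lemma insplit_edges:
  assumes fin: "finite V" and vw: "v \<in> V" "w \<in> V" "w \<noteq> v" and z: "z \<notin> V"
    and cr: "A w v = c + r" and c: "c \<noteq> 0" and other: "r \<noteq> 0 \<or> (\<exists>x\<in>V. x \<noteq> w \<and> A x v \<noteq> 0)"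
    and row: "\<And>y. y \<in> V \<Longrightarrow> A v y \<noteq> \<infinity>" and emits: "\<exists>y\<in>V. A v y \<noteq> 0"
  shows "move_equiv (mat_graph V A) (mat_graph (insert z V)
    (\<lambda>x y. if y = z then (if x = w then c else 0) else if x = z then A v y
           else if x = w \<and> y = v then r else A x y))"
    (is "move_equiv ?G (mat_graph _ ?A')")
proof -
  let ?E = "mat_graph (insert z V) ?A'"
  obtain S where S: "ecard {i. enat i < A w v \<and> i \<in> S} = c" "ecard {i. enat i < A w v \<and> i \<notin> S} = r"
    using split_index_set[OF cr[symmetric]] by blast
  define p where "p e = (if enc_src e = w \<and> enc_idx e \<in> S then 1 else 0::nat)" for e
  let ?H = "I_result ?G v 2 p"
  obtain i where i: "enat i < A w v" "i \<in> S"
  proof -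
    have "{i. enat i < A w v \<and> i \<in> S} \<noteq> {}" using S(1) c by (metis ecard_eq_0_iff)
    then show ?thesis using that by blast
  qed
  have f: "enc w v i \<in> in_edges ?G v" "p (enc w v i) = 1"
    using i vw by (simp_all add: in_edges_def enc_in_mat_graph p_def)
  obtain g where g: "g \<in> in_edges ?G v" "p g = 0"
  proof (cases "r = 0")
    case False
    have "{i. enat i < A w v \<and> i \<notin> S} \<noteq> {}" using S(2) False by (metis ecard_eq_0_iff)
    then obtain k where "enat k < A w v" "k \<notin> S" by blast
    then show ?thesis using that[of "enc w v k"] vw by (simp add: in_edges_def enc_in_mat_graph p_def)
  next
    case True
    then obtain x where "x \<in> V" "x \<noteq> w" "A x v \<noteq> 0" using other by auto
    then show ?thesis using that[of "enc x v 0"] vw by (simp add: in_edges_def nonzero_mat_edge p_def)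
  qed
  have "move_I ?G ?H"
    unfolding move_I_def
  proof (intro bexI[of _ v] exI[of _ 2] exI[of _ p] conjI)
    show "\<forall>i<2. {e \<in> in_edges ?G v. p e = i} \<noteq> {}"
    proof (intro allI impI)
      fix i :: nat assume "i < 2"
      then consider "i = 0" | "i = 1" by linarith
      then show "{e \<in> in_edges ?G v. p e = i} \<noteq> {}"
        using f g by cases auto
    qed
    obtain y where y: "y \<in> V" "A v y \<noteq> 0" using emits by blast
    then have "enc v y 0 \<in> out_edges ?G v" using vw by (simp add: out_edges_def nonzero_mat_edge)
    then show "regular ?G v"
      using finite_out_edges_mat_graph[of V v A] fin vw(1) row by (auto simp: regular_def)
  qed (use vw f in \<open>auto simp: p_def\<close>)
  moreover have "graph_iso ?E ?H"
  proof (rule graph_isoI[where \<phi> = "\<lambda>x. if x = z then (v, 1) else (x, 0)"])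
    show "wf_graph ?E" "wf_graph ?H"
      using fin vw by (auto intro!: wf_mat_graph wf_I_result simp: p_def)
    show "bij_betw (\<lambda>x. if x = z then (v, 1) else (x, 0)) (verts ?E) (verts ?H)"
      using bij_betw_split_vertex[OF vw(1) z] by (simp add: I_result_def)
    have cnt: "ecard {e \<in> edges ?G. enc_src e = x \<and> enc_rng e = v \<and> p e = i}
        = (if i = 0 then if x = w then r else A x v else if x = w then c else 0)"
      if x: "x \<in> V" and i: "i < 2" for x i
    proof -
      consider "x = w" "i = 0" | "x = w" "i = 1" | "x \<noteq> w" "i = 0" | "x \<noteq> w" "i = 1" using i by linarith
      then show ?thesis
      proof cases
        case 1
        then have "{e \<in> edges ?G. enc_src e = x \<and> enc_rng e = v \<and> p e = i}
          = {e \<in> edges ?G. enc_src e = w \<and> enc_rng e = v \<and> enc_idx e \<notin> S}"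
          by (auto simp: p_def)
        then show ?thesis using 1 S(2) ecard_mat_graph[OF vw(2,1), of A "\<lambda>k. k \<notin> S"] by simp
      next
        case 2
        then have "{e \<in> edges ?G. enc_src e = x \<and> enc_rng e = v \<and> p e = i}
          = {e \<in> edges ?G. enc_src e = w \<and> enc_rng e = v \<and> enc_idx e \<in> S}"
          by (auto simp: p_def)
        then show ?thesis using 2 S(1) ecard_mat_graph[OF vw(2,1), of A "\<lambda>k. k \<in> S"] by simp
      next
        case 3
        then have "{e \<in> edges ?G. enc_src e = x \<and> enc_rng e = v \<and> p e = i}
          = {e \<in> edges ?G. enc_src e = x \<and> enc_rng e = v \<and> True}"
          by (auto simp: p_def)
        then show ?thesis using 3 ecard_mat_graph[OF x vw(1), of A "\<lambda>_. True"] by simp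
      next
        case 4
        then have "{e \<in> edges ?G. enc_src e = x \<and> enc_rng e = v \<and> p e = i} = {}"
          by (auto simp: p_def)
        then show ?thesis using 4 by (simp del: Collect_empty_eq)
      qed
    qed
    fix x y assume xy: "x \<in> verts ?E" "y \<in> verts ?E"
    have uz: "w \<noteq> z" "v \<noteq> z" using vw z by auto
    have c0: "\<And>y x. y \<noteq> v \<Longrightarrow> x \<noteq> v \<Longrightarrow> x \<in> V \<Longrightarrow> y \<in> V \<Longrightarrow> ecount ?H (x, 0) (y, 0) = A x y"
      using ecount_I_result(1)[of _ v _ ?G] by (simp add: ecount_mat_graph)
    have c1: "\<And>x i. x \<noteq> v \<Longrightarrow> x \<in> V \<Longrightarrow> i < 2 \<Longrightarrow> ecount ?H (x, 0) (v, i)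
       = (if i = 0 then if x = w then r else A x v else if x = w then c else 0)"
      using ecount_I_result(2)[of _ v ?G] cnt by simp
    have c2: "\<And>y j. y \<noteq> v \<Longrightarrow> y \<in> V \<Longrightarrow> j < 2 \<Longrightarrow> ecount ?H (v, j) (y, 0) = A v y"
      using ecount_I_result(3)[of _ v _ _ ?G] vw by (simp add: ecount_mat_graph)
    have c3: "\<And>i j. i < 2 \<Longrightarrow> j < 2 \<Longrightarrow> ecount ?H (v, j) (v, i) = (if i = 0 then A v v else 0)"
      using ecount_I_result(4)[of _ _ ?G v] cnt[OF vw(1)] vw by simp
    have e: "ecount ?E x y = ?A' x y" using xy by (simp add: ecount_mat_graph)
    show "ecount ?E x y = ecount ?H (if x = z then (v, 1) else (x, 0)) (if y = z then (v, 1) else (y, 0))"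
      unfolding e using xy uz vw(3) z
      by (cases "x = z"; cases "y = z"; cases "x = v"; cases "y = v"; simp add: c0 c1 c2 c3 flip: One_nat_def)
  qed
  ultimately show ?thesis using move_equiv_I[OF wf_mat_graph wf_mat_graph] fin by blast
qed

text \<open>Move (R) at \<open>z\<close>. Column \<open>z\<close> may be zero altogether, in which
  case \<open>z\<close> and its edge simply disappear, and \<open>A w z\<close> may also be
  infinite.\<close>

lemma reduce_vertex:
  assumes fin: "finite V" and z: "z \<in> V" and vw: "v \<in> V" "w \<in> V" "v \<noteq> z" "w \<noteq> z"
    and out: "\<And>y. y \<in> V \<Longrightarrow> A z y = (if y = v then 1 else 0)"
    and into: "\<And>x. x \<in> V \<Longrightarrow> x \<noteq> w \<Longrightarrow> A x z = 0"
  shows "move_equiv (mat_graph V A) (mat_graph (V - {z})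
    (\<lambda>x y. if x = w \<and> y = v then A w v + A w z else A x y))"
    (is "move_equiv ?G ?E")
proof -
  let ?H = "R_result ?G z (enc z v 0) w"
  have oe: "out_edges ?G z = {enc z v 0}"
    using z vw out by (auto simp: out_edges_def mat_graph_edges enc_eq_iff zero_enat_def one_enat_def split: if_splits)
  have ie: "\<forall>e\<in>in_edges ?G z. src ?G e = w"
    using into by (force simp: in_edges_def mat_graph_edges)
  have "move_R ?G ?H"
    unfolding move_R_def using oe ie z vw
    by (intro bexI[of _ z] exI[of _ "enc z v 0"] exI[of _ w]) (auto simp: regular_def)
  moreover have "graph_iso ?E ?H"
  proof (rule graph_isoI[where \<phi> = id])
    show "wf_graph ?E" using fin by (simp add: wf_mat_graph)
    show "wf_graph ?H" using fin vw oe by (intro wf_R_result wf_mat_graph) auto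
    show "bij_betw id (verts ?E) (verts ?H)" by (simp add: R_result_def)
    fix x y assume "x \<in> verts ?E" "y \<in> verts ?E"
    then show "ecount ?E x y = ecount ?H (id x) (id y)"
      using z vw by (subst ecount_R_result[OF _ _ oe ie]) (auto simp: ecount_mat_graph)
  qed
  ultimately show ?thesis using move_equiv_R[OF wf_mat_graph wf_mat_graph] fin by blast
qed

lemma move_equiv_mat_graph_cong:
  assumes "move_equiv (mat_graph V A) (mat_graph W B)" "V = V'" "W = W'"
    "\<And>x y. x \<in> V' \<Longrightarrow> y \<in> V' \<Longrightarrow> A x y = A' x y" "\<And>x y. x \<in> W' \<Longrightarrow> y \<in> W' \<Longrightarrow> B x y = B' x y"
  shows "move_equiv (mat_graph V' A') (mat_graph W' B')"
  using assms mat_graph_cong[of V' A A'] mat_graph_cong[of W' B B'] by simp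

section \<open>Adding rows and columns\<close>

text \<open>Edges leaving \<open>z\<close> are split off one at a time: the temporary vertex
  \<open>t\<close> has the single entrance \<open>u\<close> and the single exit \<open>v\<close>, so
  contracting it leaves one edge from \<open>u\<close> to \<open>v\<close>. When a single edge is
  left, \<open>z\<close> itself can be contracted.\<close>

lemma drain_out:
  assumes fin: "finite V" and u: "u \<in> V" and z: "z \<notin> V" 
    and into: "\<And>x. x \<in> insert z V \<Longrightarrow> A x z = (if x = u then 1 else 0)"
    and out: "\<And>y. y \<in> V \<Longrightarrow> A z y = enat (b y)" and pos: "\<exists>y\<in>V. b y \<noteq> 0"
  shows "move_equiv (mat_graph (insert z V) A) (mat_graph V (\<lambda>x y. if x = u then A u y + A z y else A x y))"
  using into out pos
proof (induction "\<Sum>y\<in>V. b y" arbitrary: A b rule: less_induct)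
  case less
  note into = less.prems(1) and out = less.prems(2)
  have uz: "u \<noteq> z" using u z by auto
  have Azz: "A z z = 0" using into[of z] uz by simp
  obtain v where v: "v \<in> V" "b v \<noteq> 0" using less.prems(3) by blast
  show ?case
  proof (cases "b v = 1 \<and> (\<forall>y\<in>V. y \<noteq> v \<longrightarrow> b y = 0)")
    case True
    show ?thesis
      by (rule move_equiv_mat_graph_cong[OF reduce_vertex[of "insert z V" z v u A]])
        (use True fin z u v uz into out Azz in \<open>auto simp: one_enat_def zero_enat_def\<close>)
  next
    case False
    obtain t where t: "t \<notin> insert z V" using fin by (meson ex_new_if_finite finite_insert infinite_UNIV_nat)
    have ne: "t \<noteq> z" "t \<noteq> u" "t \<noteq> v" "z \<noteq> v" "z \<notin> V" "t \<notin> V" using t z v u by auto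
    define A1 where "A1 = (\<lambda>x y. if x = t then (if y = v then 1 else 0) else if y = t then A x z
           else if x = z \<and> y = v then A z v - 1 else A x y)"
    have "move_equiv (mat_graph (insert z V) A) (mat_graph (insert t (insert z V)) A1)"
      unfolding A1_def
    proof (rule outsplit_one_edge)
      show "2 \<le> A z v \<or> (\<exists>y\<in>insert z V. y \<noteq> v \<and> A z y \<noteq> 0)"
        using False v out by (auto simp: numeral_eq_enat zero_enat_def)
      show "A z v \<noteq> 0" using v out by (simp add: zero_enat_def)
    qed (use fin v ne t in auto)
    also have "move_equiv \<dots> (mat_graph (insert t (insert z V) - {t}) (\<lambda>x y. if x = u \<and> y = v then A1 u v + A1 u t else A1 x y))"
      by (rule reduce_vertex) (use fin v u ne into Azz uz in \<open>auto simp: A1_def\<close>)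
    finally have 1: "move_equiv (mat_graph (insert z V) A)
       (mat_graph (insert t (insert z V) - {t}) (\<lambda>x y. if x = u \<and> y = v then A1 u v + A1 u t else A1 x y))" .
    define A2 where "A2 = (\<lambda>x y. if x = u \<and> y = v then A u v + 1 else if x = z \<and> y = v then A z v - 1 else A x y)"
    have 2: "move_equiv (mat_graph (insert z V) A) (mat_graph (insert z V) A2)"
      by (rule move_equiv_mat_graph_cong[OF 1]) (use ne uz u into in \<open>auto simp: A1_def A2_def\<close>)
    have 3: "move_equiv (mat_graph (insert z V) A2) (mat_graph V (\<lambda>x y. if x = u then A2 u y + A2 z y else A2 x y))"
    proof (rule less.hyps)
      show "sum (b(v := b v - 1)) V < sum b V"
        by (rule sum_strict_mono_ex1) (use fin v in auto)
      show "\<exists>y\<in>V. (b(v := b v - 1)) y \<noteq> 0" using False v by auto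
    qed (use into out ne uz in \<open>auto simp: A2_def one_enat_def\<close>)
    \<comment> \<open>Subtraction on \<open>enat\<close> is truncated; \<open>A z v\<close> is at
      least 1 here, so the edge taken from row \<open>z\<close> is the one gained by row
      \<open>u\<close>.\<close>
    have 4: "A u v + 1 + (A z v - 1) = A u v + A z v"
      using v out by (cases "A u v") (auto simp: one_enat_def)
    show ?thesis
      by (rule move_equiv_mat_graph_cong[OF meq_trans[OF 2 3]]) (use ne uz u 4 in \<open>auto simp: A2_def\<close>)
  qed
qed

text \<open>In-splitting \<open>v\<close> along one edge from \<open>u\<close> gives a vertex
  \<open>z\<close> that repeats row \<open>v\<close> and can be drained into \<open>u\<close>. The
  edge used is lost, so \<open>A v v\<close> counts as \<open>A v v - 1\<close>, whence rows of
  \<open>A - I\<close>. The loop at \<open>v\<close> keeps the other part of the splitting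
  non-empty.\<close>

lemma row_addition:
  assumes fin: "finite V" and uv: "u \<in> V" "v \<in> V" "u \<noteq> v"
    and row: "\<And>y. y \<in> V \<Longrightarrow> A v y \<noteq> \<infinity>" and loop: "A v v \<noteq> 0" and edge: "A u v \<noteq> 0"
  shows "move_equiv (mat_graph V A)
     (mat_graph V (\<lambda>x y. if x = u then A u y + (if y = v then A v v - 1 else A v y) else A x y))"
proof -
  obtain z where z: "z \<notin> V" using fin by (meson ex_new_if_finite infinite_UNIV_nat)
  have ne: "z \<noteq> u" "z \<noteq> v" using z uv by auto
  define A1 where "A1 = (\<lambda>x y. if y = z then (if x = u then 1 else 0) else if x = z then A v y
           else if x = u \<and> y = v then A u v - 1 else A x y)"
  have 1: "1 + (A u v - 1) = A u v" using edge by (cases "A u v") (auto simp: one_enat_def zero_enat_def)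
  have 3: "A u v - 1 + A v v = A u v + (A v v - 1)"
    using edge loop row[OF uv(2)] by (cases "A u v"; cases "A v v") (auto simp: one_enat_def zero_enat_def)
  have "move_equiv (mat_graph V A) (mat_graph (insert z V) A1)"
    unfolding A1_def
  proof (rule insplit_edges)
    show "A u v - 1 \<noteq> 0 \<or> (\<exists>x\<in>V. x \<noteq> u \<and> A x v \<noteq> 0)" using uv loop by (intro disjI2 bexI[of _ v]) auto
  qed (use fin uv z row loop 1 in auto)
  moreover have "move_equiv (mat_graph (insert z V) A1) (mat_graph V (\<lambda>x y. if x = u then A1 u y + A1 z y else A1 x y))"
  proof (rule drain_out)
    show "A1 z y = enat (the_enat (A v y))" if "y \<in> V" for y
      using that z row[OF that] by (cases "A v y") (auto simp: A1_def)
    show "\<exists>y\<in>V. the_enat (A v y) \<noteq> 0"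
      using uv loop row[OF uv(2)] by (intro bexI[of _ v]) (cases "A v v", auto simp: zero_enat_def)
  qed (use fin uv z in \<open>auto simp: A1_def\<close>)
  ultimately have "move_equiv (mat_graph V A) (mat_graph V (\<lambda>x y. if x = u then A1 u y + A1 z y else A1 x y))"
    by (rule meq_trans)
  then show ?thesis
    by (rule move_equiv_mat_graph_cong) (use z ne uv 3 in \<open>auto simp: A1_def\<close>)
qed

text \<open>Dual to \<open>drain_out\<close>, but \<open>z\<close> may receive infinitely many edges
  from one vertex. So all edges from one source are split off together, and the induction runs over
  the number of sources.\<close>

lemma drain_in:
  assumes fin: "finite V" and v: "v \<in> V" and z: "z \<notin> V"
    and out: "\<And>y. y \<in> insert z V \<Longrightarrow> A z y = (if y = v then 1 else 0)"
  shows "move_equiv (mat_graph (insert z V) A) (mat_graph V (\<lambda>x y. if y = v then A x v + A x z else A x y))"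
  using out
proof (induction "card {x \<in> V. A x z \<noteq> 0}" arbitrary: A rule: less_induct)
  case less
  note out = less.prems
  have vz: "v \<noteq> z" using v z by auto
  have Azz: "A z z = 0" using out[of z] vz by simp
  show ?case
  proof (cases "\<exists>w\<in>V. \<forall>x\<in>V. x \<noteq> w \<longrightarrow> A x z = 0")
    case True
    then obtain w where w: "w \<in> V" "\<And>x. x \<in> V \<Longrightarrow> x \<noteq> w \<Longrightarrow> A x z = 0" by blast
    show ?thesis
      by (rule move_equiv_mat_graph_cong[OF reduce_vertex[of "insert z V" z v w A]])
        (use fin z v w vz out Azz in auto)
  next
    case False
    obtain w where w: "w \<in> V" "A w z \<noteq> 0" using False v by blast
    obtain x where x: "x \<in> V" "x \<noteq> w" "A x z \<noteq> 0" using False w by blast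
    obtain t where t: "t \<notin> insert z V" using fin by (meson ex_new_if_finite finite_insert infinite_UNIV_nat)
    have ne: "t \<noteq> z" "t \<noteq> v" "t \<noteq> w" "z \<noteq> w" "z \<notin> V" "t \<notin> V" using t z v w by auto
    define A1 where "A1 = (\<lambda>x y. if y = t then (if x = w then A w z else 0) else if x = t then A z y
           else if x = w \<and> y = z then 0 else A x y)"
    \<comment> \<open>Here \<open>r = 0\<close>: every edge from \<open>w\<close> to
      \<open>z\<close> is redirected to \<open>t\<close>, and \<open>x\<close> keeps the other part
      non-empty.\<close>
    have "move_equiv (mat_graph (insert z V) A) (mat_graph (insert t (insert z V)) A1)"
      unfolding A1_def by (rule insplit_edges) (use fin v w x ne out in \<open>auto simp del: not_infinity_eq\<close>)
    also have "move_equiv \<dots> (mat_graph (insert t (insert z V) - {t}) (\<lambda>x y. if x = w \<and> y = v then A1 w v + A1 w t else A1 x y))"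
      by (rule reduce_vertex) (use fin v w ne out Azz vz in \<open>auto simp: A1_def\<close>)
    finally have 1: "move_equiv (mat_graph (insert z V) A)
       (mat_graph (insert t (insert z V) - {t}) (\<lambda>x y. if x = w \<and> y = v then A1 w v + A1 w t else A1 x y))" .
    define A2 where "A2 = (\<lambda>x y. if x = w \<and> y = v then A w v + A w z else if x = w \<and> y = z then 0 else A x y)"
    have 2: "move_equiv (mat_graph (insert z V) A) (mat_graph (insert z V) A2)"
      by (rule move_equiv_mat_graph_cong[OF 1]) (use ne vz in \<open>auto simp: A1_def A2_def\<close>)
    have 3: "move_equiv (mat_graph (insert z V) A2) (mat_graph V (\<lambda>x y. if y = v then A2 x v + A2 x z else A2 x y))"
    proof (rule less.hyps)
      have "{x \<in> V. A2 x z \<noteq> 0} = {x \<in> V. A x z \<noteq> 0} - {w}" using vz by (auto simp: A2_def)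
      then show "card {x \<in> V. A2 x z \<noteq> 0} < card {x \<in> V. A x z \<noteq> 0}"
        using w fin card_Diff1_less[of "{x \<in> V. A x z \<noteq> 0}" w] by simp
    qed (use out ne in \<open>auto simp: A2_def\<close>)
    show ?thesis
      by (rule move_equiv_mat_graph_cong[OF meq_trans[OF 2 3]]) (use ne vz in \<open>auto simp: A2_def\<close>)
  qed
qed

text \<open>Out-splitting \<open>u\<close> along one edge to \<open>v\<close> gives a vertex
  \<open>z\<close> that repeats column \<open>u\<close> and emits one edge to \<open>v\<close>. Row
  \<open>u\<close> may be infinite, so columns belonging to infinite emitters can be added
  too.\<close>

lemma column_addition:
  assumes fin: "finite V" and uv: "u \<in> V" "v \<in> V" "u \<noteq> v"
    and loop: "A u u \<noteq> 0" and edge: "A u v \<noteq> 0"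
  shows "move_equiv (mat_graph V A)
     (mat_graph V (\<lambda>x y. if y = v then A x v + (if x = u then A u u - 1 else A x u) else A x y))"
proof -
  obtain z where z: "z \<notin> V" using fin by (meson ex_new_if_finite infinite_UNIV_nat)
  have ne: "z \<noteq> u" "z \<noteq> v" using z uv by auto
  define A1 where "A1 = (\<lambda>x y. if x = z then (if y = v then 1 else 0) else if y = z then A x u
           else if x = u \<and> y = v then A u v - 1 else A x y)"
  have 3: "A u v - 1 + A u u = A u v + (A u u - 1)"
    using edge loop by (cases "A u v"; cases "A u u") (auto simp: one_enat_def zero_enat_def)
  have "move_equiv (mat_graph V A) (mat_graph (insert z V) A1)"
    unfolding A1_def by (rule outsplit_one_edge) (use fin uv z loop edge in auto)
  moreover have "move_equiv (mat_graph (insert z V) A1) (mat_graph V (\<lambda>x y. if y = v then A1 x v + A1 x z else A1 x y))"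
    by (rule drain_in) (use fin uv z ne in \<open>auto simp: A1_def\<close>)
  ultimately have "move_equiv (mat_graph V A) (mat_graph V (\<lambda>x y. if y = v then A1 x v + A1 x z else A1 x y))"
    by (rule meq_trans)
  then show ?thesis
    by (rule move_equiv_mat_graph_cong) (use z ne uv 3 in \<open>auto simp: A1_def\<close>)
qed

section \<open>Smith normal form by elementary operations\<close>

definition row_op :: "nat \<Rightarrow> nat \<Rightarrow> int \<Rightarrow> (nat \<Rightarrow> nat \<Rightarrow> int) \<Rightarrow> nat \<Rightarrow> nat \<Rightarrow> int" where
  "row_op i j c C = (\<lambda>x y. if x = i then C i y + c * C j y else C x y)"

definition col_op :: "nat \<Rightarrow> nat \<Rightarrow> int \<Rightarrow> (nat \<Rightarrow> nat \<Rightarrow> int) \<Rightarrow> nat \<Rightarrow> nat \<Rightarrow> int" where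
  "col_op v u c C = (\<lambda>x y. if y = v then C x v + c * C x u else C x y)"

definition row_ops :: "nat set \<Rightarrow> nat \<Rightarrow> (nat \<Rightarrow> int) \<Rightarrow> (nat \<Rightarrow> nat \<Rightarrow> int) \<Rightarrow> nat \<Rightarrow> nat \<Rightarrow> int" where
  "row_ops S u t C = (\<lambda>x y. if x \<in> S then C x y + t x * C u y else C x y)"

definition col_ops :: "nat set \<Rightarrow> nat \<Rightarrow> (nat \<Rightarrow> int) \<Rightarrow> (nat \<Rightarrow> nat \<Rightarrow> int) \<Rightarrow> nat \<Rightarrow> nat \<Rightarrow> int" where
  "col_ops S u t C = (\<lambda>x y. if y \<in> S then C x y + t y * C x u else C x y)"

lemma row_ops_empty [simp]: "row_ops {} u t C = C"
  by (simp add: row_ops_def)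

lemma col_ops_empty [simp]: "col_ops {} u t C = C"
  by (simp add: col_ops_def)

lemma row_ops_insert: "v \<notin> S \<Longrightarrow> u \<notin> S \<Longrightarrow> row_ops (insert v S) u t C = row_op v u (t v) (row_ops S u t C)"
  by (auto simp: row_ops_def row_op_def fun_eq_iff)

lemma col_ops_insert: "v \<notin> S \<Longrightarrow> u \<notin> S \<Longrightarrow> col_ops (insert v S) u t C = col_op v u (t v) (col_ops S u t C)"
  by (auto simp: col_ops_def col_op_def fun_eq_iff)

lemma row_op_cancel [simp]: "i \<noteq> j \<Longrightarrow> row_op i j (- c) (row_op i j c C) = C"
  by (auto simp: row_op_def fun_eq_iff)

lemma col_op_cancel [simp]: "v \<noteq> u \<Longrightarrow> col_op v u (- c) (col_op v u c C) = C"
  by (auto simp: col_op_def fun_eq_iff)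

text \<open>Additions only, since the moves imitate these. Matrices are functions, so a block is
  addressed by its index sets \<open>R\<close> and \<open>L\<close> without re-indexing; entries
  outside the block change along with their row or column.\<close>

inductive elem_equiv :: "nat set \<Rightarrow> nat set \<Rightarrow> (nat \<Rightarrow> nat \<Rightarrow> int) \<Rightarrow> (nat \<Rightarrow> nat \<Rightarrow> int) \<Rightarrow> bool" for R L where
  refl: "elem_equiv R L M M"
| row: "elem_equiv R L M N \<Longrightarrow> i \<in> R \<Longrightarrow> j \<in> R \<Longrightarrow> i \<noteq> j \<Longrightarrow> elem_equiv R L M (row_op i j c N)"
| col: "elem_equiv R L M N \<Longrightarrow> v \<in> L \<Longrightarrow> u \<in> L \<Longrightarrow> v \<noteq> u \<Longrightarrow> elem_equiv R L M (col_op v u c N)"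

lemma elem_equiv_trans: "elem_equiv R L M N \<Longrightarrow> elem_equiv R L K M \<Longrightarrow> elem_equiv R L K N"
  by (induction rule: elem_equiv.induct) (auto intro: elem_equiv.intros)

lemma elem_equiv_mono: "elem_equiv R L M N \<Longrightarrow> R \<subseteq> R' \<Longrightarrow> L \<subseteq> L' \<Longrightarrow> elem_equiv R' L' M N"
  by (induction rule: elem_equiv.induct) (auto intro: elem_equiv.intros)

lemma elem_equiv_row_ops:
  assumes "finite S" "S \<subseteq> R" "u \<in> R" "u \<notin> S"
  shows "elem_equiv R L C (row_ops S u t C)"
  using assms by (induction S rule: finite_induct) (auto simp: row_ops_insert intro: elem_equiv.intros)

lemma elem_equiv_col_ops:
  assumes "finite S" "S \<subseteq> L" "u \<in> L" "u \<notin> S"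
  shows "elem_equiv R L C (col_ops S u t C)"
  using assms by (induction S rule: finite_induct) (auto simp: col_ops_insert intro: elem_equiv.intros)

text \<open>Operations on the block extend into row \<open>r\<close> and column \<open>c\<close>,
  where they only add zeros; the corner lies in no row or column of the block.\<close>

lemma elem_equiv_border:
  assumes "elem_equiv R L M N" "r \<notin> R" "c \<notin> L" "\<forall>i\<in>R. M i c = 0" "\<forall>j\<in>L. M r j = 0"
  shows "(\<forall>i\<in>R. N i c = 0) \<and> (\<forall>j\<in>L. N r j = 0) \<and> N r c = M r c"
  using assms by (induction rule: elem_equiv.induct) (auto simp: row_op_def col_op_def)

lemma elem_equiv_dvd:
  assumes "elem_equiv R L M N" "\<forall>i\<in>R. \<forall>j\<in>L. g dvd M i j"
  shows "\<forall>i\<in>R. \<forall>j\<in>L. g dvd N i j"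
  using assms by (induction rule: elem_equiv.induct) (auto simp: row_op_def col_op_def)

text \<open>Replaces a sign change: some column \<open>k\<close> other than \<open>s\<close> is made
  non-zero in row \<open>s\<close>, and a multiple of it lifts the corner above 0. The assumption
  \<open>s + 1 < q\<close> provides this second column.\<close>

lemma elem_equiv_positive_corner:
  assumes sp: "s < p" "s + 1 < q" and nz: "i \<in> {s..<p}" "j \<in> {s..<q}" "M i j \<noteq> 0"
  shows "\<exists>N. elem_equiv {s..<p} {s..<q} M N \<and> N s s > 0"
proof -
  let ?eq = "elem_equiv {s..<p} {s..<q}"
  obtain N1 where N1: "?eq M N1" "N1 s j \<noteq> 0"
  proof (cases "M s j = 0")
    case True
    then have "i \<noteq> s" using nz by auto
    then have "elem_equiv {s..<p} {s..<q} M (row_op s i 1 M)"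
      using nz sp by (intro elem_equiv.row elem_equiv.refl) auto
    then show ?thesis using that[of "row_op s i 1 M"] True nz by (simp add: row_op_def)
  next
    case False
    then show ?thesis using that[of M] elem_equiv.refl by blast
  qed
  \<comment> \<open>If the corner is the only known non-zero entry of row \<open>s\<close>, column
    \<open>s\<close> is added to column \<open>s + 1\<close>.\<close>
  obtain N2 k where N2: "?eq M N2" "k \<in> {s+1..<q}" "N2 s k \<noteq> 0"
  proof (cases "j = s \<and> N1 s (s + 1) = 0")
    case True
    have "elem_equiv {s..<p} {s..<q} M (col_op (s+1) s 1 N1)"
      using N1 sp by (intro elem_equiv.col) auto
    then show ?thesis using that[of "col_op (s+1) s 1 N1" "s+1"] True N1 sp by (simp add: col_op_def)
  next
    case False
    then consider "j \<noteq> s" | "N1 s (s+1) \<noteq> 0" by blast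
    then show ?thesis using that[of N1 j] that[of N1 "s+1"] N1 nz sp by cases auto
  qed
  \<comment> \<open>With this sign and size the amount added to the corner is at least
    \<open>\<bar>N2 s s\<bar> + 1\<close>.\<close>
  define c where "c = sgn (N2 s k) * (\<bar>N2 s s\<bar> + 1)"
  have "c * N2 s k = \<bar>N2 s k\<bar> * (\<bar>N2 s s\<bar> + 1)"
    by (simp add: c_def abs_sgn algebra_simps)
  also have "\<dots> \<ge> 1 * (\<bar>N2 s s\<bar> + 1)" using N2(3) by (intro mult_right_mono) auto
  finally have "N2 s s + c * N2 s k > 0" using abs_ge_minus_self[of "N2 s s"] by simp
  moreover have "?eq M (col_op s k c N2)" using N2 sp by (intro elem_equiv.col) auto
  ultimately show ?thesis by (intro exI[of _ "col_op s k c N2"]) (simp add: col_op_def)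
qed

text \<open>For \<open>r = x mod g\<close> the value is \<open>1 + (g - 1) mod r\<close>, hence
  between 1 and \<open>r\<close>. It is a smaller positive pivot, obtained where Euclid's algorithm
  would swap.\<close>

lemma remainder_reduction:
  fixes g x :: int
  assumes "g > 0" "\<not> g dvd x"
  shows "0 < g - ((g - 1) div (x mod g)) * (x mod g)" "g - ((g - 1) div (x mod g)) * (x mod g) < g"
proof -
  let ?r = "x mod g"
  have r: "0 < ?r" "?r < g" using assms pos_mod_bound[of g x] pos_mod_sign[of g x] by (auto simp: dvd_eq_mod_eq_0 order_less_le)
  have "g - 1 = (g - 1) div ?r * ?r + (g - 1) mod ?r" by (rule div_mult_mod_eq[symmetric])
  moreover have "0 \<le> (g - 1) mod ?r" "(g - 1) mod ?r < ?r" using r by auto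
  ultimately show "0 < g - ((g - 1) div ?r) * ?r" "g - ((g - 1) div ?r) * ?r < g"
    using r by linarith+
qed

text \<open>The least positive corner reachable by operations is the pivot: if it failed to divide
  an entry of its row or column, \<open>remainder_reduction\<close> would give a smaller
  one.\<close>

lemma elem_equiv_pivot:
  assumes sp: "s < p" "s + 1 < q" and nz: "i \<in> {s..<p}" "j \<in> {s..<q}" "M i j \<noteq> 0"
  shows "\<exists>N. elem_equiv {s..<p} {s..<q} M N \<and> N s s > 0 \<and> (\<forall>i\<in>{s+1..<p}. N i s = 0) \<and>
    (\<forall>j\<in>{s+1..<q}. N s j = 0) \<and> (\<forall>i\<in>{s+1..<p}. \<forall>j\<in>{s+1..<q}. N s s dvd N i j)"
proof -
  let ?eq = "elem_equiv {s..<p} {s..<q}"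
  define P where "P k \<longleftrightarrow> (\<exists>N. ?eq M N \<and> N s s = int k \<and> k > 0)" for k
  define g where "g = (LEAST k. P k)"
  have "\<exists>k. P k"
    using elem_equiv_positive_corner[of s p q i j M, OF assms] unfolding P_def
    by (metis nonneg_int_cases of_nat_0_less_iff order_less_imp_le)
  then have "P g" unfolding g_def by (rule LeastI_ex)
  then obtain N0 where N0: "?eq M N0" "N0 s s = int g" and g: "g > 0" unfolding P_def by blast
  have least: "int g \<le> N s s" if "?eq M N" "N s s > 0" for N
  proof -
    have "P (nat (N s s))" unfolding P_def using that by (intro exI[of _ N]) auto
    then have "g \<le> nat (N s s)" unfolding g_def by (rule Least_le)
    with that show ?thesis by simp
  qed
  have row: "int g dvd N s j" if N: "?eq M N" "N s s = int g" and j: "j \<in> {s+1..<q}" for N j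
  proof (rule ccontr)
    assume nd: "\<not> int g dvd N s j"
    let ?r = "N s j mod int g"
    define N1 where "N1 = col_op j s (- (N s j div int g)) N"
    \<comment> \<open>Column \<open>j\<close> now carries the remainder \<open>?r\<close> in row
      \<open>s\<close>; column \<open>s\<close> is lowered by a multiple of it.\<close>
    define N2 where "N2 = col_op s j (- ((int g - 1) div ?r)) N1"
    have "?eq M N2" unfolding N2_def N1_def using N j sp by (intro elem_equiv.col) auto
    moreover have "N2 s s = int g - ((int g - 1) div ?r) * ?r"
      using j N by (simp add: N2_def N1_def col_op_def minus_div_mult_eq_mod)
    ultimately show False using least[of N2] remainder_reduction[of "int g" "N s j"] g nd by auto
  qed
  have col: "int g dvd N i s" if N: "?eq M N" "N s s = int g" and i: "i \<in> {s+1..<p}" for N i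
  proof (rule ccontr)
    assume nd: "\<not> int g dvd N i s"
    let ?r = "N i s mod int g"
    define N1 where "N1 = row_op i s (- (N i s div int g)) N"
    define N2 where "N2 = row_op s i (- ((int g - 1) div ?r)) N1"
    have "?eq M N2" unfolding N2_def N1_def using N i sp by (intro elem_equiv.row) auto
    moreover have "N2 s s = int g - ((int g - 1) div ?r) * ?r"
      using i N by (simp add: N2_def N1_def row_op_def minus_div_mult_eq_mod)
    ultimately show False using least[of N2] remainder_reduction[of "int g" "N i s"] g nd by auto
  qed
  define N1 where "N1 = col_ops {s+1..<q} s (\<lambda>j. - (N0 s j div int g)) N0"
  have N1: "?eq M N1" unfolding N1_def
    by (rule elem_equiv_trans[OF elem_equiv_col_ops N0(1)]) (use sp in auto)
  have N1s: "N1 s s = int g" using N0 by (simp add: N1_def col_ops_def)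
  have N1r: "N1 s j = 0" if "j \<in> {s+1..<q}" for j
    using row[OF N0 that] that N0(2) by (simp add: N1_def col_ops_def)
  define N2 where "N2 = row_ops {s+1..<p} s (\<lambda>i. - (N1 i s div int g)) N1"
  have N2: "?eq M N2" unfolding N2_def
    by (rule elem_equiv_trans[OF elem_equiv_row_ops N1]) (use sp in auto)
  have N2s: "N2 s s = int g" using N1s by (simp add: N2_def row_ops_def)
  have N2r: "N2 s j = 0" if "j \<in> {s+1..<q}" for j
    using N1r[OF that] by (simp add: N2_def row_ops_def)
  have N2c: "N2 i s = 0" if "i \<in> {s+1..<p}" for i
    using col[OF N1 N1s that] that N1s by (simp add: N2_def row_ops_def)
  have "int g dvd N2 i j" if ij: "i \<in> {s+1..<p}" "j \<in> {s+1..<q}" for i j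
  proof -
    \<comment> \<open>Adding row \<open>i\<close> to row \<open>s\<close> keeps the corner, as
      \<open>N2 i s = 0\<close>, and copies \<open>N2 i j\<close> into the pivot row, where
      divisibility is known.\<close>
    have "?eq M (row_op s i 1 N2)" using N2 ij sp by (intro elem_equiv.row) auto
    from row[OF this _ ij(2)] show ?thesis using N2s N2r[OF ij(2)] N2c[OF ij(1)] by (simp add: row_op_def)
  qed
  then show ?thesis using N2 N2s N2r N2c g by (intro exI[of _ N2]) auto
qed

text \<open>Since \<open>q\<close> exceeds \<open>p\<close>, every remaining block has a second
  column, even at the last row, so each pivot can be made positive. Later operations keep an earlier
  pivot a divisor of the whole block, which gives the chain.\<close>

lemma elem_equiv_smith:
  assumes "s \<le> p" "p < q"
  shows "\<exists>N a. elem_equiv {s..<p} {s..<q} M N \<and>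
    (\<forall>i\<in>{s..<p}. \<forall>j\<in>{s..<q}. N i j = (if i = j then a i else 0)) \<and>
    (\<forall>i\<in>{s..<p}. 0 \<le> a i) \<and> (\<forall>i. s \<le> i \<and> Suc i < p \<longrightarrow> a i dvd a (Suc i))"
  using assms(1)
proof (induction "p - s" arbitrary: s M)
  case 0
  then show ?case by (intro exI[of _ M]) (auto intro: elem_equiv.refl)
next
  case (Suc k)
  show ?case
  proof (cases "\<forall>i\<in>{s..<p}. \<forall>j\<in>{s..<q}. M i j = 0")
    case True
    then show ?thesis by (intro exI[of _ M] exI[of _ "\<lambda>_. 0"]) (auto intro: elem_equiv.refl)
  next
    case False
    have sp: "s < p" "s + 1 < q" using Suc assms by auto
    obtain N where N: "elem_equiv {s..<p} {s..<q} M N" "N s s > 0" "\<forall>i\<in>{s+1..<p}. N i s = 0"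
      "\<forall>j\<in>{s+1..<q}. N s j = 0" "\<forall>i\<in>{s+1..<p}. \<forall>j\<in>{s+1..<q}. N s s dvd N i j"
      using False elem_equiv_pivot[OF sp] by blast
    have "k = p - (s + 1)" "s + 1 \<le> p" using Suc sp by auto
    from Suc.hyps(1)[OF this, of N] obtain N' a where
      N': "elem_equiv {s+1..<p} {s+1..<q} N N'"
        "\<forall>i\<in>{s+1..<p}. \<forall>j\<in>{s+1..<q}. N' i j = (if i = j then a i else 0)"
        "\<forall>i\<in>{s+1..<p}. 0 \<le> a i" "\<forall>i. s + 1 \<le> i \<and> Suc i < p \<longrightarrow> a i dvd a (Suc i)"
      by blast
    have border: "\<forall>i\<in>{s+1..<p}. N' i s = 0" "\<forall>j\<in>{s+1..<q}. N' s j = 0" "N' s s = N s s"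
      using elem_equiv_border[OF N'(1), of s s] N by auto
    have dv: "\<forall>i\<in>{s+1..<p}. \<forall>j\<in>{s+1..<q}. N s s dvd N' i j"
      using elem_equiv_dvd[OF N'(1) N(5)] .
    define b where "b = a(s := N s s)"
    have "elem_equiv {s..<p} {s..<q} M N'"
      by (rule elem_equiv_trans[OF elem_equiv_mono[OF N'(1)] N(1)]) auto
    moreover have "\<forall>i\<in>{s..<p}. \<forall>j\<in>{s..<q}. N' i j = (if i = j then b i else 0)"
    proof (intro ballI)
      fix i j assume ij: "i \<in> {s..<p}" "j \<in> {s..<q}"
      consider "i = s" "j = s" | "i = s" "j \<in> {s+1..<q}" | "i \<in> {s+1..<p}" "j = s"
        | "i \<in> {s+1..<p}" "j \<in> {s+1..<q}" using ij by fastforce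
      then show "N' i j = (if i = j then b i else 0)"
        using border N'(2) by cases (auto simp: b_def)
    qed
    moreover have "\<forall>i\<in>{s..<p}. 0 \<le> b i" using N'(3) N(2) by (auto simp: b_def)
    moreover have "b i dvd b (Suc i)" if i: "s \<le> i" "Suc i < p" for i
    proof (cases "i = s")
      case True
      have "s + 1 \<in> {s+1..<p}" "s + 1 \<in> {s+1..<q}" using True i assms by auto
      then have "N s s dvd N' (s+1) (s+1)" "N' (s+1) (s+1) = a (s+1)" using dv N'(2) by (blast, simp)
      then show ?thesis using True by (simp add: b_def)
    next
      case False
      then show ?thesis using N'(4) i by (simp add: b_def)
    qed
    ultimately show ?thesis by blast
  qed
qed

section \<open>Equivalence over the integers\<close>

definition unimodular :: "nat \<Rightarrow> int mat \<Rightarrow> bool" where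
  "unimodular n P \<longleftrightarrow> P \<in> carrier_mat n n \<and> (\<exists>P' \<in> carrier_mat n n. P * P' = 1\<^sub>m n \<and> P' * P = 1\<^sub>m n)"

lemma unimodularI: "P \<in> carrier_mat n n \<Longrightarrow> P' \<in> carrier_mat n n \<Longrightarrow> P * P' = 1\<^sub>m n \<Longrightarrow> P' * P = 1\<^sub>m n \<Longrightarrow> unimodular n P"
  unfolding unimodular_def by blast

lemma unimodular_one: "unimodular n (1\<^sub>m n)"
  by (rule unimodularI[of _ n "1\<^sub>m n"]) auto

lemma unimodular_mult:
  assumes "unimodular n P" "unimodular n Q"
  shows "unimodular n (P * Q)"
proof -
  obtain P' Q' where c: "P \<in> carrier_mat n n" "Q \<in> carrier_mat n n" "P' \<in> carrier_mat n n" "Q' \<in> carrier_mat n n"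
    and i: "P * P' = 1\<^sub>m n" "P' * P = 1\<^sub>m n" "Q * Q' = 1\<^sub>m n" "Q' * Q = 1\<^sub>m n"
    using assms unfolding unimodular_def by blast
  have "P * Q * (Q' * P') = P * (Q * Q') * P'" using c by (simp add: assoc_mult_mat[of _ n n _ n _ n])
  then have 1: "P * Q * (Q' * P') = 1\<^sub>m n" using c i by simp
  have "Q' * P' * (P * Q) = Q' * (P' * P) * Q" using c by (simp add: assoc_mult_mat[of _ n n _ n _ n])
  then have 2: "Q' * P' * (P * Q) = 1\<^sub>m n" using c i by simp
  show ?thesis by (rule unimodularI[OF _ _ 1 2]) (use c in auto)
qed

lemma unimodular_if_invertible:
  assumes "invertible_mat P" "P \<in> carrier_mat n n"
  shows "unimodular n P"
proof -
  obtain B where B: "P * B = 1\<^sub>m (dim_row P)" "B * P = 1\<^sub>m (dim_row B)"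
    using assms unfolding invertible_mat_def inverts_mat_def by blast
  have "dim_col B = n" using arg_cong[OF B(1), of dim_col] assms(2) by auto
  moreover have "dim_row B = n" using arg_cong[OF B(2), of dim_col] assms(2) by auto
  ultimately show ?thesis using B assms(2) by (intro unimodularI[of P n B]) auto
qed

lemma unimodular_addrow_mat: "k < n \<Longrightarrow> l < n \<Longrightarrow> k \<noteq> l \<Longrightarrow> unimodular n (addrow_mat n a k l)"
  by (rule unimodularI[OF addrow_mat_carrier addrow_mat_carrier addrow_mat_inv])
    (use addrow_mat_inv[of k n l "- a"] in auto)

definition fun_mat :: "nat \<Rightarrow> nat \<Rightarrow> (nat \<Rightarrow> nat \<Rightarrow> int) \<Rightarrow> int mat" where
  "fun_mat m n C = mat m n (\<lambda>(i,j). C i j)"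

lemma fun_mat_carrier [simp]: "fun_mat m n C \<in> carrier_mat m n"
  by (simp add: fun_mat_def)

lemma fun_mat_cong: "(\<And>i j. i < m \<Longrightarrow> j < n \<Longrightarrow> C i j = C' i j) \<Longrightarrow> fun_mat m n C = fun_mat m n C'"
  by (auto simp: fun_mat_def)

text \<open>Determinant -1 is allowed on either side: this relation records the elementary divisors
  and says nothing about moves.\<close>

definition int_equiv :: "nat \<Rightarrow> nat \<Rightarrow> (nat \<Rightarrow> nat \<Rightarrow> int) \<Rightarrow> (nat \<Rightarrow> nat \<Rightarrow> int) \<Rightarrow> bool" where
  "int_equiv m n C C' \<longleftrightarrow> (\<exists>P Q. unimodular m P \<and> unimodular n Q \<and> fun_mat m n C' = P * fun_mat m n C * Q)"

lemma int_equiv_cong: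
  assumes "int_equiv m n C C'" "\<And>i j. i < m \<Longrightarrow> j < n \<Longrightarrow> C i j = D i j" "\<And>i j. i < m \<Longrightarrow> j < n \<Longrightarrow> C' i j = D' i j"
  shows "int_equiv m n D D'"
  using assms fun_mat_cong[of m n C D] fun_mat_cong[of m n C' D'] by (simp add: int_equiv_def)

lemma int_equiv_refl: "int_equiv m n C C"
proof -
  have "fun_mat m n C = 1\<^sub>m m * fun_mat m n C * 1\<^sub>m n"
    using left_mult_one_mat[OF fun_mat_carrier] right_mult_one_mat[OF fun_mat_carrier] by simp
  then show ?thesis unfolding int_equiv_def using unimodular_one by blast
qed

lemma int_equiv_trans:
  assumes "int_equiv m n C D" "int_equiv m n D E"
  shows "int_equiv m n C E"
proof -
  obtain P Q where PQ: "unimodular m P" "unimodular n Q" "fun_mat m n D = P * fun_mat m n C * Q"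
    using assms(1) unfolding int_equiv_def by blast
  obtain P' Q' where PQ': "unimodular m P'" "unimodular n Q'" "fun_mat m n E = P' * fun_mat m n D * Q'"
    using assms(2) unfolding int_equiv_def by blast
  have c: "P \<in> carrier_mat m m" "P' \<in> carrier_mat m m" "Q \<in> carrier_mat n n" "Q' \<in> carrier_mat n n"
    using PQ PQ' by (auto simp: unimodular_def)
  have C: "fun_mat m n C \<in> carrier_mat m n" by simp
  have "fun_mat m n E = P' * (P * fun_mat m n C * Q) * Q'" using PQ PQ' by simp
  also have "\<dots> = (P' * P) * fun_mat m n C * (Q * Q')"
    using c C by (smt (verit) assoc_mult_mat mult_carrier_mat)
  finally show ?thesis unfolding int_equiv_def
    using unimodular_mult[OF PQ'(1) PQ(1)] unimodular_mult[OF PQ(2) PQ'(2)] by blast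
qed

lemma int_equiv_sym:
  assumes "int_equiv m n C D"
  shows "int_equiv m n D C"
proof -
  obtain P Q where PQ: "unimodular m P" "unimodular n Q" "fun_mat m n D = P * fun_mat m n C * Q"
    using assms(1) unfolding int_equiv_def by blast
  then obtain P' Q' where c: "P \<in> carrier_mat m m" "P' \<in> carrier_mat m m" "Q \<in> carrier_mat n n" "Q' \<in> carrier_mat n n"
    and i: "P' * P = 1\<^sub>m m" "P * P' = 1\<^sub>m m" "Q * Q' = 1\<^sub>m n" "Q' * Q = 1\<^sub>m n"
    by (auto simp: unimodular_def)
  have C: "fun_mat m n C \<in> carrier_mat m n" by simp
  have "P' * fun_mat m n D * Q' = (P' * P) * fun_mat m n C * (Q * Q')"
    unfolding PQ(3) using c C by (smt (verit) assoc_mult_mat mult_carrier_mat)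
  also have "\<dots> = fun_mat m n C"
    unfolding i using left_mult_one_mat[OF C] right_mult_one_mat[OF C] by simp
  finally have "fun_mat m n C = P' * fun_mat m n D * Q'" ..
  moreover have "unimodular m P'" "unimodular n Q'" using c i by (auto intro: unimodularI)
  ultimately show ?thesis unfolding int_equiv_def by blast
qed

lemma int_equiv_left:
  assumes "unimodular m P" "fun_mat m n D = P * fun_mat m n C"
  shows "int_equiv m n C D"
proof -
  have "P * fun_mat m n C \<in> carrier_mat m n" using assms(1) by (auto simp: unimodular_def)
  then have "fun_mat m n D = P * fun_mat m n C * 1\<^sub>m n"
    using assms(2) right_mult_one_mat[of "P * fun_mat m n C" m n] by simp
  then show ?thesis unfolding int_equiv_def using assms(1) unimodular_one by blast
qed

lemma int_equiv_row_op: "i < m \<Longrightarrow> j < m \<Longrightarrow> i \<noteq> j \<Longrightarrow> int_equiv m n C (row_op i j c C)"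
proof (rule int_equiv_left[OF unimodular_addrow_mat[of i m j c]])
  assume ij: "i < m" "j < m" "i \<noteq> j"
  have "fun_mat m n (row_op i j c C) = addrow c i j (fun_mat m n C)"
    using ij by (intro eq_matI) (auto simp: fun_mat_def row_op_def)
  then show "fun_mat m n (row_op i j c C) = addrow_mat m c i j * fun_mat m n C"
    using addrow_mat[of "fun_mat m n C" m n j c i] ij by simp
qed

lemma int_equiv_col_op:
  assumes vu: "v < n" "u < n" "v \<noteq> u"
  shows "int_equiv m n C (col_op v u c C)"
proof -
  have "fun_mat m n (col_op v u c C) = addcol c v u (fun_mat m n C)"
    using vu by (intro eq_matI) (auto simp: fun_mat_def col_op_def mat_addcol_def)
  also have "\<dots> = fun_mat m n C * addrow_mat n c u v"
    using addcol_mat[of "fun_mat m n C" m n u c v] vu by simp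
  also have "\<dots> = 1\<^sub>m m * fun_mat m n C * addrow_mat n c u v"
    using left_mult_one_mat[of "fun_mat m n C" m n] by simp
  finally show ?thesis
    unfolding int_equiv_def using unimodular_one unimodular_addrow_mat[of u n v c] vu by metis
qed

lemma int_equiv_if_elem_equiv: "elem_equiv {..<m} {..<n} C D \<Longrightarrow> int_equiv m n C D"
  by (induction rule: elem_equiv.induct)
    (auto intro: int_equiv_refl int_equiv_trans int_equiv_row_op int_equiv_col_op)

text \<open>A fact about \<open>int_equiv\<close> alone, since odd permutations have determinant -1;
  it serves to compute the elementary divisors of \<open>B\<close>.\<close>

lemma int_equiv_permute_rows:
  assumes "bij_betw \<sigma> {..<m} {..<m}"
  shows "int_equiv m n C (\<lambda>i. C (\<sigma> i))"
proof -
  define P :: "(nat \<Rightarrow> nat) \<Rightarrow> int mat" where "P \<tau> = mat m m (\<lambda>(i,j). if j = \<tau> i then 1 else 0)" for \<tau>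
  define \<tau> where "\<tau> = inv_into {..<m} \<sigma>"
  have lt: "\<sigma> i < m" "\<tau> i < m" if "i < m" for i
    using bij_betw_apply[OF assms, of i] bij_betw_apply[OF bij_betw_inv_into[OF assms], of i] that
    by (auto simp: \<tau>_def)
  have inv: "\<tau> (\<sigma> i) = i" "\<sigma> (\<tau> i) = i" if "i < m" for i
    using that bij_betw_inv_into_left[OF assms] bij_betw_inv_into_right[OF assms] by (auto simp: \<tau>_def)
  have c: "P \<rho> \<in> carrier_mat m m" for \<rho> by (simp add: P_def)
  have left: "P \<rho> * M = mat m k (\<lambda>(i,j). M $$ (\<rho> i, j))"
    if "M \<in> carrier_mat m k" "\<And>i. i < m \<Longrightarrow> \<rho> i < m" for M k \<rho>
  proof (rule eq_matI)
    fix i j assume "i < dim_row (mat m k (\<lambda>(i,j). M $$ (\<rho> i, j)))" "j < dim_col (mat m k (\<lambda>(i,j). M $$ (\<rho> i, j)))"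
    then have ij: "i < m" "j < k" by auto
    then have "(P \<rho> * M) $$ (i,j) = (\<Sum>l = 0..<m. (if l = \<rho> i then 1 else 0) * M $$ (l,j))"
      using that by (auto simp: P_def scalar_prod_def intro!: sum.cong)
    also have "\<dots> = (\<Sum>l = 0..<m. if l = \<rho> i then M $$ (l,j) else 0)"
      by (intro sum.cong) auto
    also have "\<dots> = M $$ (\<rho> i, j)" using that(2)[OF ij(1)] by simp
    finally show "(P \<rho> * M) $$ (i,j) = mat m k (\<lambda>(i,j). M $$ (\<rho> i, j)) $$ (i,j)" using ij by simp
  qed (use that c in \<open>auto simp: P_def\<close>)
  have "P \<sigma> * P \<tau> = mat m m (\<lambda>(i,j). P \<tau> $$ (\<sigma> i, j))" by (rule left) (use c lt in auto)
  also have "\<dots> = 1\<^sub>m m" using lt inv by (intro eq_matI) (auto simp: P_def)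
  finally have 1: "P \<sigma> * P \<tau> = 1\<^sub>m m" .
  have "P \<tau> * P \<sigma> = mat m m (\<lambda>(i,j). P \<sigma> $$ (\<tau> i, j))" by (rule left) (use c lt in auto)
  also have "\<dots> = 1\<^sub>m m" using lt inv by (intro eq_matI) (auto simp: P_def)
  finally have 2: "P \<tau> * P \<sigma> = 1\<^sub>m m" .
  have "P \<sigma> * fun_mat m n C = mat m n (\<lambda>(i,j). fun_mat m n C $$ (\<sigma> i, j))"
    by (rule left) (use lt in auto)
  also have "\<dots> = fun_mat m n (\<lambda>i. C (\<sigma> i))"
    using lt by (intro eq_matI) (auto simp: fun_mat_def)
  finally have "fun_mat m n (\<lambda>i. C (\<sigma> i)) = P \<sigma> * fun_mat m n C" ..
  then show ?thesis using int_equiv_left unimodularI[OF c c 1 2] by blast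
qed

section \<open>Uniqueness of the diagonal form\<close>

lemma dvd_det_zero_block:
  fixes Q :: "int mat"
  assumes Q: "Q \<in> carrier_mat n n" and i: "i < n"
    and dv: "\<And>a b. a \<le> i \<Longrightarrow> i \<le> b \<Longrightarrow> b < n \<Longrightarrow> t dvd Q $$ (a,b)"
  shows "t dvd det Q"
  unfolding det_def'[OF Q]
proof (intro dvd_sum dvd_mult)
  fix p assume "p \<in> {p. p permutes {0..<n}}"
  then have p: "p permutes {0..<n}" by simp
  \<comment> \<open>The \<open>i + 1\<close> rows up to \<open>i\<close> do not inject into the
    \<open>i\<close> columns before \<open>i\<close>, so every term of the Leibniz expansion has a
    factor in the block.\<close>
  have "\<exists>a\<le>i. i \<le> p a"
  proof (rule ccontr)
    assume "\<not> (\<exists>a\<le>i. i \<le> p a)"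
    then have "p ` {..i} \<subseteq> {..<i}" by auto
    then have "card (p ` {..i}) \<le> card {..<i}" by (intro card_mono) auto
    moreover have "card (p ` {..i}) = card {..i}"
      by (intro card_image inj_on_subset[OF permutes_inj[OF p]]) auto
    ultimately show False by simp
  qed
  then obtain a where a: "a \<le> i" "i \<le> p a" by blast
  have "p a < n" using permutes_in_image[OF p, of a] a i by auto
  then have "t dvd Q $$ (a, p a)" using dv a by blast
  also have "Q $$ (a, p a) dvd (\<Prod>i = 0..<n. Q $$ (i, p i))"
    using a i by (intro dvd_prodI) auto
  finally show "t dvd (\<Prod>i = 0..<n. Q $$ (i, p i))" .
qed

lemma chain_dvd:
  fixes a :: "nat \<Rightarrow> int"
  assumes "\<And>i. Suc i < m \<Longrightarrow> a i dvd a (Suc i)" "i \<le> j" "j < m"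
  shows "a i dvd a j"
  using assms(2,3)
proof (induction j rule: dec_induct)
  case (step j)
  then show ?case using assms(1)[of j] dvd_trans by (metis Suc_lessD)
qed simp

definition diag_fun :: "(nat \<Rightarrow> int) \<Rightarrow> nat \<Rightarrow> nat \<Rightarrow> int" where
  "diag_fun a i j = (if i = j then a i else 0)"

text \<open>If \<open>P D = D' Q\<close>, then \<open>a i / gcd (a i) (b i)\<close> divides the entries of \<open>Q\<close> in the rows up to \<open>i\<close>
  and the columns from \<open>i\<close> on, a block so large that every term of \<open>det Q\<close> meets it.\<close>

lemma int_equiv_diag_dvd:
  assumes eq: "int_equiv m n (diag_fun a) (diag_fun b)" and mn: "m \<le> n"
    and a: "\<And>i. Suc i < m \<Longrightarrow> a i dvd a (Suc i)" and b: "\<And>i. Suc i < m \<Longrightarrow> b i dvd b (Suc i)"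
    and i: "i < m"
  shows "a i dvd b i"
proof (cases "b i = 0")
  case False
  obtain P R where PR: "unimodular m P" "unimodular n R" "fun_mat m n (diag_fun b) = P * fun_mat m n (diag_fun a) * R"
    using eq unfolding int_equiv_def by blast
  then obtain Q where c: "P \<in> carrier_mat m m" "R \<in> carrier_mat n n" "Q \<in> carrier_mat n n"
    and inv: "R * Q = 1\<^sub>m n" unfolding unimodular_def by blast
  have "fun_mat m n (diag_fun b) * Q = P * fun_mat m n (diag_fun a) * (R * Q)"
    unfolding PR(3) by (rule assoc_mult_mat[OF mult_carrier_mat[OF c(1) fun_mat_carrier] c(2,3)])
  also have "\<dots> = P * fun_mat m n (diag_fun a)"
    unfolding inv using right_mult_one_mat[OF mult_carrier_mat[OF c(1) fun_mat_carrier]] .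
  finally have E: "fun_mat m n (diag_fun b) * Q = P * fun_mat m n (diag_fun a)" .
  \<comment> \<open>Entrywise form of \<open>E\<close>: row \<open>x\<close> of \<open>Q\<close> is
    scaled by \<open>b x\<close>, column \<open>y\<close> of \<open>P\<close> by \<open>a y\<close>,
    and columns from \<open>m\<close> on vanish on the right.\<close>
  have ent: "b x * Q $$ (x,y) = (if y < m then P $$ (x,y) * a y else 0)" if "x < m" "y < n" for x y
  proof -
    have "(fun_mat m n (diag_fun b) * Q) $$ (x,y) = (\<Sum>l = 0..<n. (if x = l then b x else 0) * Q $$ (l,y))"
      using that c by (auto simp: fun_mat_def diag_fun_def scalar_prod_def intro!: sum.cong)
    also have "\<dots> = (\<Sum>l = 0..<n. if x = l then b x * Q $$ (l,y) else 0)"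
      by (intro sum.cong) auto
    also have "\<dots> = b x * Q $$ (x,y)" using that mn by simp
    finally have 1: "(fun_mat m n (diag_fun b) * Q) $$ (x,y) = b x * Q $$ (x,y)" .
    have "(P * fun_mat m n (diag_fun a)) $$ (x,y) = (\<Sum>l = 0..<m. P $$ (x,l) * (if l = y then a l else 0))"
      using that c by (auto simp: fun_mat_def diag_fun_def scalar_prod_def intro!: sum.cong)
    also have "\<dots> = (\<Sum>l = 0..<m. if l = y then P $$ (x,l) * a l else 0)"
      by (intro sum.cong) auto
    also have "\<dots> = (if y < m then P $$ (x,y) * a y else 0)" by simp
    finally show ?thesis using 1 E by simp
  qed
  define g where "g = gcd (a i) (b i)"
  have g: "g \<noteq> 0" using False by (simp add: g_def)
  define t where "t = a i div g"
  have at: "a i = g * t" by (simp add: t_def g_def)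
  define s where "s = b i div g"
  have bs: "b i = g * s" by (simp add: s_def g_def)
  have cop: "coprime t s"
    unfolding t_def s_def g_def using False by (intro div_gcd_coprime) simp
  have "t dvd Q $$ (x,y)" if xy: "x \<le> i" "i \<le> y" "y < n" for x y
  proof -
    have "a i dvd b x * Q $$ (x,y)"
      using ent[of x y] xy i chain_dvd[of m a i y, OF a] by (auto intro: dvd_mult)
    moreover have "b x dvd b i" using chain_dvd[of m b x i, OF b] xy i by auto
    ultimately have "a i dvd b i * Q $$ (x,y)" by (meson dvd_refl dvd_trans mult_dvd_mono)
    then have "t dvd s * Q $$ (x,y)" unfolding at bs using g by (simp add: mult.assoc)
    then show ?thesis using cop by (simp add: coprime_dvd_mult_right_iff)
  qed
  then have "t dvd det Q" using dvd_det_zero_block[OF c(3), of i t] i mn by auto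
  moreover have "det R * det Q = 1" using det_mult[OF c(2,3)] inv by simp
  \<comment> \<open>\<open>det Q\<close> is a unit, so \<open>t\<close> is one as well and
    \<open>a i\<close> divides \<open>g\<close>, hence \<open>b i\<close>.\<close>
  ultimately have "t dvd 1" by (metis dvd_mult)
  then have "a i dvd g" unfolding at by (simp add: mult_dvd_mono[of g g t 1, simplified])
  then show ?thesis unfolding g_def using dvd_trans gcd_dvd2 by blast
qed simp

lemma int_equiv_diag_unique:
  assumes "int_equiv m n (diag_fun a) (diag_fun b)" "m \<le> n"
    and "\<And>i. Suc i < m \<Longrightarrow> a i dvd a (Suc i)" "\<And>i. Suc i < m \<Longrightarrow> b i dvd b (Suc i)"
    and "\<And>i. i < m \<Longrightarrow> 0 \<le> a i" "\<And>i. i < m \<Longrightarrow> 0 \<le> b i" and "i < m"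
  shows "a i = b i"
  using int_equiv_diag_dvd[of m n a b i] int_equiv_diag_dvd[of m n b a i] int_equiv_sym assms
  by (simp add: zdvd_antisym_nonneg)

section \<open>Moves between integer matrices\<close>

text \<open>The matrix \<open>J + C\<close>; rows from \<open>m\<close> on are infinite whatever
  \<open>C\<close> is there. \<open>nat\<close> sends negative entries to 0, so this is faithful
  only for a \<open>nonneg_fun\<close>.\<close>

definition mat_of_fun :: "nat \<Rightarrow> (nat \<Rightarrow> nat \<Rightarrow> int) \<Rightarrow> nat \<Rightarrow> nat \<Rightarrow> enat" where
  "mat_of_fun m C x y = (if x < m then enat (nat (C x y)) + (if x = y then 1 else 0) else \<infinity>)"

text \<open>Both relations in one, so that a chain of moves also transports the elementary
  divisors.\<close>

definition fun_equiv :: "nat \<Rightarrow> nat \<Rightarrow> (nat \<Rightarrow> nat \<Rightarrow> int) \<Rightarrow> (nat \<Rightarrow> nat \<Rightarrow> int) \<Rightarrow> bool" where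
  "fun_equiv m n C C' \<longleftrightarrow> int_equiv m n C C' \<and>
     move_equiv (mat_graph {..<n} (mat_of_fun m C)) (mat_graph {..<n} (mat_of_fun m C'))"

definition nonneg_fun :: "nat \<Rightarrow> nat \<Rightarrow> (nat \<Rightarrow> nat \<Rightarrow> int) \<Rightarrow> bool" where
  "nonneg_fun m n C \<longleftrightarrow> (\<forall>i<m. \<forall>j<n. 0 \<le> C i j)"

lemma fun_equiv_refl: "fun_equiv m n C C"
  by (simp add: fun_equiv_def int_equiv_refl meq_refl wf_mat_graph)

lemma fun_equiv_sym: "fun_equiv m n C D \<Longrightarrow> fun_equiv m n D C"
  by (auto simp: fun_equiv_def intro: int_equiv_sym meq_sym)

lemma fun_equiv_trans: "fun_equiv m n C D \<Longrightarrow> fun_equiv m n D E \<Longrightarrow> fun_equiv m n C E"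
  by (auto simp: fun_equiv_def intro: int_equiv_trans meq_trans)

declare fun_equiv_trans [trans]

lemma fun_equiv_cong:
  assumes "fun_equiv m n C C'"
    "\<And>i j. i < m \<Longrightarrow> j < n \<Longrightarrow> C i j = D i j" "\<And>i j. i < m \<Longrightarrow> j < n \<Longrightarrow> C' i j = D' i j"
  shows "fun_equiv m n D D'"
  unfolding fun_equiv_def
proof
  show "int_equiv m n D D'" using int_equiv_cong[of m n C C' D D'] assms by (simp add: fun_equiv_def)
  show "move_equiv (mat_graph {..<n} (mat_of_fun m D)) (mat_graph {..<n} (mat_of_fun m D'))"
    by (rule move_equiv_mat_graph_cong[of "{..<n}" "mat_of_fun m C" "{..<n}" "mat_of_fun m C'"])
      (use assms in \<open>auto simp: fun_equiv_def mat_of_fun_def\<close>)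
qed

text \<open>The finite rows of \<open>A\<close> are those of \<open>I + C\<close>, so a row of
  \<open>A - I\<close> is a row of \<open>C\<close>. The identity part supplies the loop at
  \<open>j\<close>, and \<open>C i j > 0\<close> the edge.\<close>

lemma fun_equiv_row_op_one:
  assumes ij: "i < m" "j < m" "i \<noteq> j" "m \<le> n" and nn: "nonneg_fun m n C" and pos: "C i j > 0"
  shows "fun_equiv m n C (row_op i j 1 C)"
  unfolding fun_equiv_def
proof
  show "int_equiv m n C (row_op i j 1 C)" using ij by (intro int_equiv_row_op)
  have "move_equiv (mat_graph {..<n} (mat_of_fun m C)) (mat_graph {..<n} (\<lambda>x y.
      if x = i then mat_of_fun m C i y + (if y = j then mat_of_fun m C j j - 1 else mat_of_fun m C j y)
      else mat_of_fun m C x y))"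
    by (rule row_addition) (use ij pos in \<open>auto simp: mat_of_fun_def one_enat_def zero_enat_def\<close>)
  then show "move_equiv (mat_graph {..<n} (mat_of_fun m C)) (mat_graph {..<n} (mat_of_fun m (row_op i j 1 C)))"
    by (rule move_equiv_mat_graph_cong)
      (use ij nn in \<open>auto simp: mat_of_fun_def row_op_def nonneg_fun_def one_enat_def zero_enat_def nat_add_distrib\<close>)
qed

text \<open>For \<open>m \<le> u\<close> the vertex \<open>u\<close> is an infinite emitter and has
  an edge to \<open>v\<close> anyway, so positivity concerns \<open>u < m\<close> only.\<close>

lemma fun_equiv_col_op_one:
  assumes vu: "v < n" "u < n" "v \<noteq> u" and nn: "nonneg_fun m n C" and pos: "u < m \<Longrightarrow> C u v > 0"
  shows "fun_equiv m n C (col_op v u 1 C)"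
  unfolding fun_equiv_def
proof
  show "int_equiv m n C (col_op v u 1 C)" using vu by (intro int_equiv_col_op)
  have "move_equiv (mat_graph {..<n} (mat_of_fun m C)) (mat_graph {..<n} (\<lambda>x y.
      if y = v then mat_of_fun m C x v + (if x = u then mat_of_fun m C u u - 1 else mat_of_fun m C x u)
      else mat_of_fun m C x y))"
    by (rule column_addition) (use vu pos in \<open>auto simp: mat_of_fun_def one_enat_def zero_enat_def\<close>)
  then show "move_equiv (mat_graph {..<n} (mat_of_fun m C)) (mat_graph {..<n} (mat_of_fun m (col_op v u 1 C)))"
    by (rule move_equiv_mat_graph_cong)
      (use vu nn in \<open>auto simp: mat_of_fun_def col_op_def nonneg_fun_def one_enat_def zero_enat_def nat_add_distrib\<close>)
qed

section \<open>Adding integer multiples of rows and columns by moves\<close>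

lemma row_op_Suc: "i \<noteq> j \<Longrightarrow> row_op i j (int (Suc k)) C = row_op i j 1 (row_op i j (int k) C)"
  by (auto simp: row_op_def fun_eq_iff algebra_simps)

lemma col_op_Suc: "v \<noteq> u \<Longrightarrow> col_op v u (int (Suc k)) C = col_op v u 1 (col_op v u (int k) C)"
  by (auto simp: col_op_def fun_eq_iff algebra_simps)

lemma fun_equiv_row_op_nat:
  assumes ij: "i < m" "j < m" "i \<noteq> j" "m \<le> n" and nn: "nonneg_fun m n C" and pos: "C i j > 0"
  shows "fun_equiv m n C (row_op i j (int k) C)"
proof (induction k)
  case 0
  have "row_op i j 0 C = C" by (auto simp: row_op_def fun_eq_iff)
  then show ?case by (simp add: fun_equiv_refl)
next
  case (Suc k)
  have "fun_equiv m n (row_op i j (int k) C) (row_op i j 1 (row_op i j (int k) C))"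
  proof (rule fun_equiv_row_op_one[OF ij])
    show "nonneg_fun m n (row_op i j (int k) C)" using nn ij by (simp add: nonneg_fun_def row_op_def)
    show "row_op i j (int k) C i j > 0" using nn pos ij by (simp add: nonneg_fun_def row_op_def add_pos_nonneg)
  qed
  with Suc show ?case unfolding row_op_Suc[OF ij(3)] by (rule fun_equiv_trans)
qed

lemma fun_equiv_col_op_nat:
  assumes vu: "v < n" "u < n" "v \<noteq> u" and nn: "nonneg_fun m n C" and pos: "u < m \<Longrightarrow> C u v > 0"
  shows "fun_equiv m n C (col_op v u (int k) C)"
proof (induction k)
  case 0
  have "col_op v u 0 C = C" by (auto simp: col_op_def fun_eq_iff)
  then show ?case by (simp add: fun_equiv_refl)
next
  case (Suc k)
  have "fun_equiv m n (col_op v u (int k) C) (col_op v u 1 (col_op v u (int k) C))"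
  proof (rule fun_equiv_col_op_one[OF vu])
    show "nonneg_fun m n (col_op v u (int k) C)" using nn vu by (simp add: nonneg_fun_def col_op_def)
    show "col_op v u (int k) C u v > 0" if "u < m"
      using nn pos[OF that] vu that by (simp add: nonneg_fun_def col_op_def add_pos_nonneg)
  qed
  with Suc show ?case unfolding col_op_Suc[OF vu(3)] by (rule fun_equiv_trans)
qed

text \<open>A negative multiple is undone by a positive one that starts from the result; hence the
  side conditions on both matrices.\<close>

lemma fun_equiv_row_op:
  assumes ij: "i < m" "j < m" "i \<noteq> j" "m \<le> n" and nn: "nonneg_fun m n C" "nonneg_fun m n (row_op i j c C)"
    and pos: "C i j > 0" "row_op i j c C i j > 0"
  shows "fun_equiv m n C (row_op i j c C)"
proof (cases "c \<ge> 0")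
  case True
  then show ?thesis using fun_equiv_row_op_nat[OF ij nn(1) pos(1), of "nat c"] by simp
next
  case False
  then have "fun_equiv m n (row_op i j c C) (row_op i j (- c) (row_op i j c C))"
    using fun_equiv_row_op_nat[OF ij nn(2) pos(2), of "nat (- c)"] by simp
  then show ?thesis using ij by (simp add: fun_equiv_sym)
qed

lemma fun_equiv_col_op:
  assumes vu: "v < n" "u < n" "v \<noteq> u" and nn: "nonneg_fun m n C" "nonneg_fun m n (col_op v u c C)"
    and pos: "u < m \<Longrightarrow> C u v > 0" "u < m \<Longrightarrow> col_op v u c C u v > 0"
  shows "fun_equiv m n C (col_op v u c C)"
proof (cases "c \<ge> 0")
  case True
  then show ?thesis using fun_equiv_col_op_nat[OF vu nn(1) pos(1), of "nat c"] by simp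
next
  case False
  then have "fun_equiv m n (col_op v u c C) (col_op v u (- c) (col_op v u c C))"
    using fun_equiv_col_op_nat[OF vu nn(2) pos(2), of "nat (- c)"] by simp
  then show ?thesis using vu by (simp add: fun_equiv_sym)
qed

text \<open>Conditions at the two ends suffice: on the way each row is either still the old one or
  already the final one.\<close>

lemma fun_equiv_row_ops:
  assumes "finite S" "S \<subseteq> {..<m}" "u < m" "u \<notin> S" "m \<le> n" "nonneg_fun m n C" "nonneg_fun m n (row_ops S u t C)"
    and "\<And>i. i \<in> S \<Longrightarrow> C i u > 0" "\<And>i. i \<in> S \<Longrightarrow> row_ops S u t C i u > 0"
  shows "fun_equiv m n C (row_ops S u t C)"
  using assms
proof (induction S rule: finite_induct)
  case empty
  then show ?case by (simp add: fun_equiv_refl)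
next
  case (insert v S)
  have same: "row_ops S u t C i j = row_ops (insert v S) u t C i j" if "i \<noteq> v" for i j
    using that by (simp add: row_ops_def)
  have at_v: "row_ops S u t C v j = C v j" for j using insert by (simp add: row_ops_def)
  have nn: "nonneg_fun m n (row_ops S u t C)"
    unfolding nonneg_fun_def
  proof (intro allI impI)
    fix i j assume "i < m" "j < n"
    then show "0 \<le> row_ops S u t C i j"
      using insert.prems(5,6) same[of i j] at_v[of j] by (cases "i = v") (auto simp: nonneg_fun_def)
  qed
  have "fun_equiv m n C (row_ops S u t C)"
  proof (rule insert.IH)
    show "row_ops S u t C i u > 0" if "i \<in> S" for i
      using insert.prems(8)[of i] same[of i u] insert.hyps(2) that by (cases "i = v") auto
  qed (use insert.prems nn in auto)
  also have "fun_equiv m n (row_ops S u t C) (row_ops (insert v S) u t C)"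
    using insert.prems insert.hyps nn
    by (subst row_ops_insert, simp, simp, intro fun_equiv_row_op) (auto simp: at_v row_ops_insert)
  finally show ?case .
qed

lemma fun_equiv_col_ops:
  assumes "finite S" "S \<subseteq> {..<n}" "u < n" "u \<notin> S" "nonneg_fun m n C" "nonneg_fun m n (col_ops S u t C)"
    and "\<And>j. u < m \<Longrightarrow> j \<in> S \<Longrightarrow> C u j > 0" "\<And>j. u < m \<Longrightarrow> j \<in> S \<Longrightarrow> col_ops S u t C u j > 0"
  shows "fun_equiv m n C (col_ops S u t C)"
  using assms
proof (induction S rule: finite_induct)
  case empty
  then show ?case by (simp add: fun_equiv_refl)
next
  case (insert v S)
  have same: "col_ops S u t C i j = col_ops (insert v S) u t C i j" if "j \<noteq> v" for i j
    using that by (simp add: col_ops_def)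
  have at_v: "col_ops S u t C i v = C i v" for i using insert by (simp add: col_ops_def)
  have nn: "nonneg_fun m n (col_ops S u t C)"
    unfolding nonneg_fun_def
  proof (intro allI impI)
    fix i j assume "i < m" "j < n"
    then show "0 \<le> col_ops S u t C i j"
      using insert.prems(4,5) same[of j i] at_v[of i] by (cases "j = v") (auto simp: nonneg_fun_def)
  qed
  have "fun_equiv m n C (col_ops S u t C)"
  proof (rule insert.IH)
    show "col_ops S u t C u j > 0" if "u < m" "j \<in> S" for j
      using insert.prems(7)[of j] same[of j u] insert.hyps(2) that by (cases "j = v") auto
  qed (use insert.prems nn in auto)
  also have "fun_equiv m n (col_ops S u t C) (col_ops (insert v S) u t C)"
    using insert.prems insert.hyps nn
    by (subst col_ops_insert, simp, simp, intro fun_equiv_col_op) (auto simp: at_v col_ops_insert)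
  finally show ?case .
qed

text \<open>The first column being constant, \<open>C\<close> is determined by its first row and the differences \<open>M\<close>
  of the other rows to it. Adding multiples of the first column moves the first row freely
  within its residue class modulo \<open>d\<close>, so only \<open>M\<close> matters.\<close>

definition represents :: "nat \<Rightarrow> nat \<Rightarrow> int \<Rightarrow> (nat \<Rightarrow> nat \<Rightarrow> int) \<Rightarrow> (nat \<Rightarrow> nat \<Rightarrow> int) \<Rightarrow> bool" where
  "represents m n d C M \<longleftrightarrow> (\<forall>i<m. \<forall>j<n. 0 < C i j \<and> d dvd C i j) \<and> (\<forall>i<m. C i 0 = d) \<and>
     (\<forall>i\<in>{1..<m}. \<forall>j\<in>{1..<n}. M i j = C i j - C 0 j)"

lemma represents_dvd:
  assumes "represents m n d C M" "i \<in> {1..<m}" "j \<in> {1..<n}"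
  shows "d dvd M i j"
proof -
  have "M i j = C i j - C 0 j" "d dvd C i j" "d dvd C 0 j"
    using assms by (auto simp: represents_def)
  then show ?thesis by simp
qed

text \<open>The first rows differ by multiples of \<open>d\<close> and column 0 is constantly
  \<open>d\<close>, so adding \<open>t j\<close> times column 0 to column \<open>j\<close> corrects
  all rows at once and leaves their differences alone.\<close>

lemma represents_unique:
  assumes C: "represents m n d C M" and C': "represents m n d C' M" and mn: "0 < m" "0 < n"
  shows "fun_equiv m n C C'"
proof -
  define t where "t j = (C' 0 j - C 0 j) div d" for j
  have t: "t j * d = C' 0 j - C 0 j" if "j < n" for j
  proof -
    have "d dvd C' 0 j - C 0 j" using C C' that mn by (simp add: represents_def)
    then show ?thesis by (simp add: t_def)
  qed
  have eq: "col_ops {1..<n} 0 t C i j = C' i j" if "i < m" "j < n" for i j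
  proof (cases "j = 0")
    case True
    then show ?thesis using C C' that by (simp add: col_ops_def represents_def)
  next
    case False
    have "C i j - C 0 j = C' i j - C' 0 j"
    proof (cases "i = 0")
      case False
      then show ?thesis using C C' that \<open>j \<noteq> 0\<close> by (auto simp: represents_def)
    qed simp
    then show ?thesis using False C that t[OF that(2)] by (simp add: col_ops_def represents_def)
  qed
  have "fun_equiv m n C (col_ops {1..<n} 0 t C)"
    by (rule fun_equiv_col_ops) (use C C' mn eq in \<open>auto simp: nonneg_fun_def represents_def less_imp_le\<close>)
  then show ?thesis by (rule fun_equiv_cong) (rule HOL.refl, rule eq)
qed

lemma represents_exists:
  assumes d: "d > 0" and dv: "\<And>i j. i \<in> {1..<m} \<Longrightarrow> j \<in> {1..<n} \<Longrightarrow> d dvd M i j"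
    and K: "\<And>i j. i \<in> {1..<m} \<Longrightarrow> j \<in> {1..<n} \<Longrightarrow> - M i j \<le> K"
  shows "\<exists>C. represents m n d C M \<and> (\<forall>j\<in>{1..<n}. C 0 j > K)"
proof -
  \<comment> \<open>A multiple of \<open>d\<close> exceeding \<open>K\<close>: used as first row, it
    lifts all entries \<open>M i j + X\<close> above 0.\<close>
  define X where "X = d * (1 + \<bar>K\<bar>)"
  have "1 * (1 + \<bar>K\<bar>) \<le> X" unfolding X_def using d by (intro mult_right_mono) auto
  then have X: "X > K" "X > 0" by auto
  define C where "C i j = (if j = 0 then d else if i = 0 then X else M i j + X)" for i j :: nat
  have "0 < C i j" if "i < m" "j < n" for i j
    using that K[of i j] X d by (auto simp: C_def)
  moreover have "d dvd C i j" if "i < m" "j < n" for i j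
    using that dv[of i j] by (auto simp: C_def X_def)
  ultimately show ?thesis
    using X by (intro exI[of _ C]) (auto simp: represents_def C_def)
qed

lemma entries_bounded: "\<exists>K. \<forall>i\<in>{1..<m}. \<forall>j\<in>{1..<n}. - M i j \<le> (K::int)" for M :: "nat \<Rightarrow> nat \<Rightarrow> int"
proof -
  let ?S = "(\<lambda>(i,j). - M i j) ` ({1..<m} \<times> {1..<n})"
  have "- M i j \<le> Max ?S" if "i \<in> {1..<m}" "j \<in> {1..<n}" for i j
    using that by (intro Max_ge) (auto intro!: image_eqI[of _ _ "(i, j)"])
  then show ?thesis by blast
qed

text \<open>Adding \<open>c\<close> times row \<open>j\<close> of \<open>C\<close> to row
  \<open>i\<close> changes the difference to row 0 by an excess of \<open>c\<close> times row 0,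
  which a second operation removes. Row 0 is taken above the bounds for \<open>M\<close> and for the
  result, so the final row \<open>i\<close> is positive again.\<close>

lemma represents_row_op:
  assumes d: "d > 0" and dv: "\<And>i j. i \<in> {1..<m} \<Longrightarrow> j \<in> {1..<n} \<Longrightarrow> d dvd M i j"
    and ij: "i \<in> {1..<m}" "j \<in> {1..<m}" "i \<noteq> j" and c: "c \<ge> 0" and mn: "m \<le> n"
  shows "\<exists>C C'. represents m n d C M \<and> represents m n d C' (row_op i j c M) \<and> fun_equiv m n C C'"
proof -
  obtain K1 K2 where K: "\<forall>x\<in>{1..<m}. \<forall>y\<in>{1..<n}. - M x y \<le> K1"
    "\<forall>x\<in>{1..<m}. \<forall>y\<in>{1..<n}. - row_op i j c M x y \<le> K2"
    using entries_bounded[of m n M] entries_bounded[of m n "row_op i j c M"] by blast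
  obtain C where C: "represents m n d C M" "\<forall>y\<in>{1..<n}. C 0 y > max K1 K2"
    using represents_exists[of d m n M "max K1 K2"] d dv K by fastforce
  define C1 where "C1 = row_op i j c C"
  define C2 where "C2 = row_op i 0 (- c) C1"
  have m: "0 < m" "i < m" "j < m" "i \<noteq> 0" "j \<noteq> 0" using ij by auto
  have pos: "0 < C x y" if "x < m" "y < n" for x y using C that by (auto simp: represents_def)
  have row_i: "C2 i y = C 0 y + row_op i j c M i y" if "y \<in> {1..<n}" for y
  proof -
    have M: "M i y = C i y - C 0 y" "M j y = C j y - C 0 y"
      using C(1) ij that by (auto simp: represents_def)
    show ?thesis using m ij by (simp add: C2_def C1_def row_op_def M right_diff_distrib)
  qed
  have row_i0: "C2 i 0 = d" using C(1) m mn ij by (simp add: C2_def C1_def row_op_def represents_def)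
  have other: "C2 x y = C x y" if "x \<noteq> i" for x y using that by (simp add: C2_def C1_def row_op_def)
  have pos2: "0 < C2 i y" if "y < n" for y
  proof (cases "y = 0")
    case False
    then have "C 0 y > K2" "- row_op i j c M i y \<le> K2" using C(2) K(2) ij that by auto
    then show ?thesis using row_i[of y] False that by auto
  qed (simp add: row_i0 d)
  have dv2: "d dvd C2 i y" if "y < n" for y
    using C(1) m mn that ij by (auto simp: represents_def C2_def C1_def row_op_def)
  have 1: "fun_equiv m n C C1" unfolding C1_def using ij c mn pos
    by (intro fun_equiv_row_op) (auto simp: nonneg_fun_def row_op_def add_pos_nonneg less_imp_le)
  have 2: "fun_equiv m n C1 C2"
    unfolding C2_def
  proof (rule fun_equiv_row_op)
    show "nonneg_fun m n C1" using ij c mn pos by (auto simp: nonneg_fun_def C1_def row_op_def less_imp_le)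
    show "nonneg_fun m n (row_op i 0 (- c) C1)"
      unfolding C2_def[symmetric] nonneg_fun_def using pos pos2 other by (metis less_imp_le)
    show "C1 i 0 > 0" using ij c mn pos by (auto simp: C1_def row_op_def add_pos_nonneg less_imp_le)
    show "row_op i 0 (- c) C1 i 0 > 0" unfolding C2_def[symmetric] by (simp add: row_i0 d)
  qed (use m mn in auto)
  have "represents m n d C2 (row_op i j c M)"
    unfolding represents_def
  proof (intro conjI allI impI ballI)
    fix x y assume "x < m" "y < n"
    then show "0 < C2 x y" "d dvd C2 x y"
      using C(1) pos2 dv2 other by (cases "x = i"; simp add: represents_def)+
  next
    fix x assume "x < m"
    then show "C2 x 0 = d" using C(1) row_i0 other by (cases "x = i") (auto simp: represents_def)
  next
    fix x y assume xy: "x \<in> {1..<m}" "y \<in> {1..<n}"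
    show "row_op i j c M x y = C2 x y - C2 0 y"
    proof (cases "x = i")
      case True
      then show ?thesis using row_i[OF xy(2)] other[of 0 y] m by simp
    next
      case False
      then show ?thesis using other[OF False, of y] other[of 0 y] m C(1) xy
        by (simp add: row_op_def represents_def)
    qed
  qed
  then show ?thesis using C(1) fun_equiv_trans[OF 1 2] by blast
qed

text \<open>Column operations away from column 0 commute with taking differences to row 0, and
  \<open>c \<ge> 0\<close> preserves positivity.\<close>

lemma represents_col_op:
  assumes d: "d > 0" and dv: "\<And>i j. i \<in> {1..<m} \<Longrightarrow> j \<in> {1..<n} \<Longrightarrow> d dvd M i j"
    and vu: "v \<in> {1..<n}" "u \<in> {1..<n}" "v \<noteq> u" and c: "c \<ge> 0"
  shows "\<exists>C C'. represents m n d C M \<and> represents m n d C' (col_op v u c M) \<and> fun_equiv m n C C'"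
proof -
  obtain K where K: "\<forall>x\<in>{1..<m}. \<forall>y\<in>{1..<n}. - M x y \<le> K"
    using entries_bounded[of m n M] by blast
  obtain C where C: "represents m n d C M"
    using represents_exists[of d m n M K] d dv K by fastforce
  have pos: "0 < C x y" if "x < m" "y < n" for x y using C that by (auto simp: represents_def)
  have "represents m n d (col_op v u c C) (col_op v u c M)"
    using C vu c by (auto simp: represents_def col_op_def right_diff_distrib add_pos_nonneg less_imp_le)
  moreover have "fun_equiv m n C (col_op v u c C)"
    using vu c pos by (intro fun_equiv_col_op)
      (auto simp: nonneg_fun_def col_op_def add_pos_nonneg less_imp_le)
  ultimately show ?thesis using C by blast
qed

text \<open>Each operation is carried out at a representative chosen for it, and
  \<open>represents_unique\<close> leads there from the current one. A negative \<open>c\<close> is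
  a positive one read backwards.\<close>

lemma represents_elem_equiv:
  assumes E: "elem_equiv {1..<m} {1..<n} M N" and d: "d > 0" and C: "represents m n d C M" and mn: "0 < m" "m \<le> n"
  shows "\<exists>C'. represents m n d C' N \<and> fun_equiv m n C C'"
  using E C
proof (induction rule: elem_equiv.induct)
  case (refl M)
  then show ?case using fun_equiv_refl by blast
next
  case (row M N i j c)
  then obtain C' where C': "represents m n d C' N" "fun_equiv m n C C'" by blast
  have dv: "d dvd N x y" if "x \<in> {1..<m}" "y \<in> {1..<n}" for x y using represents_dvd[OF C'(1) that] .
  have dv': "d dvd row_op i j c N x y" if "x \<in> {1..<m}" "y \<in> {1..<n}" for x y
    using dv that row.hyps by (auto simp: row_op_def)
  have "\<exists>D D'. represents m n d D N \<and> represents m n d D' (row_op i j c N) \<and> fun_equiv m n D D'"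
  proof (cases "c \<ge> 0")
    case True
    show ?thesis by (rule represents_row_op[OF d dv row.hyps(2-4) True mn(2)])
  next
    case False
    then have "\<exists>D D'. represents m n d D (row_op i j c N) \<and> represents m n d D' (row_op i j (- c) (row_op i j c N)) \<and> fun_equiv m n D D'"
      by (intro represents_row_op[OF d dv' row.hyps(2-4)]) (use mn in auto)
    then show ?thesis unfolding row_op_cancel[OF row.hyps(4)] by (blast intro: fun_equiv_sym)
  qed
  then obtain D D' where D: "represents m n d D N" "represents m n d D' (row_op i j c N)" "fun_equiv m n D D'"
    by blast
  have "fun_equiv m n C' D" using represents_unique[OF C'(1) D(1)] mn by simp
  then show ?case using C'(2) D fun_equiv_trans by blast
next
  case (col M N v u c)
  then obtain C' where C': "represents m n d C' N" "fun_equiv m n C C'" by blast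
  have dv: "d dvd N x y" if "x \<in> {1..<m}" "y \<in> {1..<n}" for x y using represents_dvd[OF C'(1) that] .
  have dv': "d dvd col_op v u c N x y" if "x \<in> {1..<m}" "y \<in> {1..<n}" for x y
    using dv that col.hyps by (auto simp: col_op_def)
  have "\<exists>D D'. represents m n d D N \<and> represents m n d D' (col_op v u c N) \<and> fun_equiv m n D D'"
  proof (cases "c \<ge> 0")
    case True
    show ?thesis by (rule represents_col_op[OF d dv col.hyps(2-4) True])
  next
    case False
    then have "\<exists>D D'. represents m n d D (col_op v u c N) \<and> represents m n d D' (col_op v u (- c) (col_op v u c N)) \<and> fun_equiv m n D D'"
      by (intro represents_col_op[OF d dv' col.hyps(2-4)]) (use mn in auto)
    then show ?thesis unfolding col_op_cancel[OF col.hyps(4)] by (blast intro: fun_equiv_sym)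
  qed
  then obtain D D' where D: "represents m n d D N" "represents m n d D' (col_op v u c N)" "fun_equiv m n D D'"
    by blast
  have "fun_equiv m n C' D" using represents_unique[OF C'(1) D(1)] mn by simp
  then show ?case using C'(2) D fun_equiv_trans by blast
qed

text \<open>Over the integers \<open>C\<close> is equivalent to \<open>d\<close> followed by its
  block of differences. Diagonalising the block thus diagonalises \<open>C\<close>, and uniqueness
  identifies the outcome with \<open>b\<close>.\<close>

lemma normal_form:
  assumes mn: "0 < m" "m < n" and d: "d > 0"
    and pos: "\<And>i j. i < m \<Longrightarrow> j < n \<Longrightarrow> 0 < C i j \<and> d dvd C i j" and col0: "\<And>i. i < m \<Longrightarrow> C i 0 = d"
    and eq: "int_equiv m n C (diag_fun b)" and b: "\<And>i. Suc i < m \<Longrightarrow> b i dvd b (Suc i)" "\<And>i. i < m \<Longrightarrow> 0 \<le> b i"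
  shows "b 0 = d" "\<exists>C'. represents m n d C' (diag_fun b) \<and> fun_equiv m n C C'"
proof -
  define N0 where "N0 = row_ops {1..<m} 0 (\<lambda>_. -1) C"
  \<comment> \<open>Among the first \<open>m\<close> rows, column 0 of \<open>N0\<close> is non-zero
    only in row 0, so clearing row 0 leaves the differences intact; the quotients are exact.\<close>
  define N where "N = col_ops {1..<n} 0 (\<lambda>j. - (C 0 j div d)) N0"
  have "elem_equiv {..<m} {..<n} C N0" unfolding N0_def
    using mn by (intro elem_equiv_row_ops) auto
  then have 1: "elem_equiv {..<m} {..<n} C N" unfolding N_def
    using mn by (intro elem_equiv_trans[OF elem_equiv_col_ops]) auto
  have N: "N 0 0 = d" "\<And>i. i \<in> {1..<m} \<Longrightarrow> N i 0 = 0" "\<And>j. j \<in> {1..<n} \<Longrightarrow> N 0 j = 0"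
    "\<And>i j. i \<in> {1..<m} \<Longrightarrow> j \<in> {1..<n} \<Longrightarrow> N i j = C i j - C 0 j"
    using mn col0 pos by (auto simp: N_def N0_def col_ops_def row_ops_def)
  have rep: "represents m n d C N" using pos col0 N(4) by (simp add: represents_def)
  obtain N' a where N': "elem_equiv {1..<m} {1..<n} N N'"
    "\<forall>i\<in>{1..<m}. \<forall>j\<in>{1..<n}. N' i j = (if i = j then a i else 0)"
    "\<forall>i\<in>{1..<m}. 0 \<le> a i" "\<forall>i. 1 \<le> i \<and> Suc i < m \<longrightarrow> a i dvd a (Suc i)"
    using elem_equiv_smith[of 1 m n N] mn by auto
  have border: "\<forall>i\<in>{1..<m}. N' i 0 = 0" "\<forall>j\<in>{1..<n}. N' 0 j = 0" "N' 0 0 = d"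
    using elem_equiv_border[OF N'(1), of 0 0] N by auto
  have dvN: "\<forall>i\<in>{1..<m}. \<forall>j\<in>{1..<n}. d dvd N' i j"
    using elem_equiv_dvd[OF N'(1)] represents_dvd[OF rep] by blast
  \<comment> \<open>\<open>d\<close> divides every entry of the block, so it can be put in front of
    the chain.\<close>
  define a' where "a' = a(0 := d)"
  have diag: "N' i j = diag_fun a' i j" if ij: "i < m" "j < n" for i j
  proof -
    consider "i = 0" "j = 0" | "i = 0" "j \<in> {1..<n}" | "i \<in> {1..<m}" "j = 0" | "i \<in> {1..<m}" "j \<in> {1..<n}"
      using ij by (cases "i = 0"; cases "j = 0") auto
    then show ?thesis using border N'(2) by cases (auto simp: diag_fun_def a'_def)
  qed
  have chain: "a' i dvd a' (Suc i)" if "Suc i < m" for i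
  proof (cases "i = 0")
    case True
    have "1 \<in> {1..<m}" "1 \<in> {1..<n}" using that True mn by auto
    then have "d dvd N' 1 1" "N' 1 1 = a 1" using dvN N'(2) by (blast, simp)
    then show ?thesis using True by (simp add: a'_def)
  qed (use N'(4) that in \<open>simp add: a'_def\<close>)
  have "elem_equiv {..<m} {..<n} C N'"
    by (rule elem_equiv_trans[OF elem_equiv_mono[OF N'(1)] 1]) auto
  then have "int_equiv m n C N'" by (rule int_equiv_if_elem_equiv)
  then have "int_equiv m n C (diag_fun a')" by (rule int_equiv_cong) (auto simp: diag)
  then have "int_equiv m n (diag_fun b) (diag_fun a')" using eq int_equiv_sym int_equiv_trans by blast
  then have ba: "b i = a' i" if "i < m" for i
    using mn b chain N'(3) d that by (intro int_equiv_diag_unique[of m n b a' i]) (auto simp: a'_def)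
  show "b 0 = d" using ba[of 0] mn by (simp add: a'_def)
  obtain C' where C': "represents m n d C' N'" "fun_equiv m n C C'"
    using represents_elem_equiv[OF N'(1) d rep] mn by auto
  have "diag_fun b i j = N' i j" if "i < m" "j < n" for i j
    using diag[OF that] ba that by (simp add: diag_fun_def)
  then have "represents m n d C' (diag_fun b)" using C'(1) by (simp add: represents_def)
  then show "\<exists>C'. represents m n d C' (diag_fun b) \<and> fun_equiv m n C C'" using C'(2) by blast
qed


lemma constant_column_equiv:
  assumes mn: "0 < m" "m < n" and d: "d > 0"
    and C: "\<And>i j. i < m \<Longrightarrow> j < n \<Longrightarrow> 0 < C i j \<and> d dvd C i j" "\<And>i. i < m \<Longrightarrow> C i 0 = d" "int_equiv m n C (diag_fun b)"
    and D: "\<And>i j. i < m \<Longrightarrow> j < n \<Longrightarrow> 0 < D i j \<and> d dvd D i j" "\<And>i. i < m \<Longrightarrow> D i 0 = d" "int_equiv m n D (diag_fun b)"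
    and b: "\<And>i. Suc i < m \<Longrightarrow> b i dvd b (Suc i)" "\<And>i. i < m \<Longrightarrow> 0 \<le> b i"
  shows "fun_equiv m n C D"
proof -
  obtain C' where C': "represents m n d C' (diag_fun b)" "fun_equiv m n C C'"
    using normal_form(2)[OF mn d C b] by blast
  obtain D' where D': "represents m n d D' (diag_fun b)" "fun_equiv m n D D'"
    using normal_form(2)[OF mn d D b] by blast
  have "fun_equiv m n C' D'" using represents_unique[OF C'(1) D'(1)] mn by simp
  then show ?thesis using C'(2) D'(2) fun_equiv_sym fun_equiv_trans by blast
qed

section \<open>The matrix \<open>B\<close>\<close>

text \<open>Padding with 0 keeps the divisibility chain, as everything divides 0.\<close>

definition divisor :: "nat list \<Rightarrow> nat \<Rightarrow> int" where
  "divisor ds i = (if i < length ds then int (ds ! i) else 0)"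

definition B_fun :: "nat list \<Rightarrow> nat \<Rightarrow> nat \<Rightarrow> int" where
  "B_fun ds i j = (if i = 0 \<or> length ds \<le> i then (if j < length ds - 1 then 0 else divisor ds (length ds - 1))
     else if j = i - 1 then divisor ds j else 0)"

lemma B_entry_B_fun:
  assumes "0 < length ds" "length ds \<le> m" "i < m"
  shows "int (B_entry m ds (i + 1) (j + 1)) = B_fun ds i j"
  using assms by (auto simp: B_entry_def B_fun_def divisor_def Let_def)

text \<open>Let \<open>k = length ds\<close>. Subtracting column \<open>k - 1\<close> from the later
  columns and row 0 from the rows from \<open>k\<close> on leaves one divisor in each of the rows 0
  to \<open>k - 1\<close>, displaced from the diagonal by a cyclic shift that
  \<open>\<sigma>\<close> undoes.\<close>

lemma B_fun_int_equiv:
  assumes k: "0 < length ds" "length ds \<le> m" and mn: "m < n"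
  shows "int_equiv m n (B_fun ds) (diag_fun (divisor ds))"
proof -
  let ?k = "length ds"
  define X where "X = col_ops {?k..<n} (?k - 1) (\<lambda>_. -1) (B_fun ds)"
  define Y where "Y = row_ops {?k..<m} 0 (\<lambda>_. -1) X"
  define \<sigma> where "\<sigma> i = (if i = ?k - 1 then 0 else if i < ?k then i + 1 else i)" for i
  have "elem_equiv {..<m} {..<n} (B_fun ds) X"
    unfolding X_def
  proof (rule elem_equiv_col_ops)
    show "?k - 1 \<notin> {?k..<n}" unfolding atLeastLessThan_iff using k(1) by linarith
  qed (use k mn in auto)
  then have "elem_equiv {..<m} {..<n} (B_fun ds) Y" unfolding Y_def
    using k less_le_trans[OF k] by (intro elem_equiv_trans[OF elem_equiv_row_ops]) auto
  then have 1: "int_equiv m n (B_fun ds) Y" by (rule int_equiv_if_elem_equiv)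
  have "bij_betw \<sigma> {..<m} {..<m}"
    by (rule bij_betw_byWitness[where f' = "\<lambda>i. if i = 0 then ?k - 1 else if i < ?k then i - 1 else i"])
      (use k in \<open>auto simp: \<sigma>_def\<close>)
  then have 2: "int_equiv m n Y (\<lambda>i. Y (\<sigma> i))" by (rule int_equiv_permute_rows)
  have X: "X i j = (if i = 0 \<or> ?k \<le> i then (if j = ?k - 1 then divisor ds (?k - 1) else 0)
     else if j = i - 1 then divisor ds j else 0)" if "j < n" for i j
    using k that by (auto simp: X_def col_ops_def B_fun_def)
  have Y: "Y i j = (if i = 0 then (if j = ?k - 1 then divisor ds (?k - 1) else 0)
     else if i < ?k \<and> j = i - 1 then divisor ds j else 0)" if "i < m" "j < n" for i j
    using k that by (auto simp: Y_def row_ops_def X)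
  have "Y (\<sigma> i) j = diag_fun (divisor ds) i j" if "i < m" "j < n" for i j
  proof -
    have "\<sigma> i < m" using k that by (auto simp: \<sigma>_def)
    then show ?thesis using k that by (auto simp: Y \<sigma>_def diag_fun_def divisor_def)
  qed
  then show ?thesis by (intro int_equiv_cong[OF int_equiv_trans[OF 1 2]]) auto
qed

text \<open>\<open>B\<close> has many zeros, so moves fill it up before its first column is reduced
  to \<open>d\<close>. The reduction uses a row that is constantly \<open>d\<close>, obtained as a
  difference of two rows.\<close>

lemma B_fun_constant_column:
  assumes k: "2 \<le> length ds" "length ds \<le> m" and mn: "m < n"
    and pos: "\<And>i. i < length ds \<Longrightarrow> 0 < ds ! i" and dvd: "\<And>i. i < length ds \<Longrightarrow> ds ! 0 dvd ds ! i"
  shows "\<exists>T. fun_equiv m n (B_fun ds) T \<and> (\<forall>i<m. \<forall>j<n. 0 < T i j \<and> divisor ds 0 dvd T i j) \<and>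
    (\<forall>i<m. T i 0 = divisor ds 0)"
proof -
  let ?k = "length ds"
  define d D where "d = divisor ds 0" and "D = divisor ds (?k - 1)"
  have dpos: "0 < divisor ds i" if "i < ?k" for i using pos[OF that] that by (simp add: divisor_def)
  have ddvd: "d dvd divisor ds i" if "i < ?k" for i
    using dvd[OF that] that k by (auto simp: d_def divisor_def)
  have d: "0 < d" unfolding d_def by (rule dpos) (use k in linarith)
  have D: "0 < D" "d dvd D" unfolding D_def by (rule dpos ddvd; use k in linarith)+
  \<comment> \<open>Vertex \<open>n - 1\<close> is an infinite emitter, as \<open>m < n\<close>, so
    its column can be added freely. It is \<open>D\<close> in row 0 and the rows from
    \<open>?k\<close> on, and 0 in the other rows.\<close>
  define B1 where "B1 = col_ops {..<?k-1} (n-1) (\<lambda>_. 1) (B_fun ds)"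
  have B1: "B1 i j = (if i = 0 \<or> ?k \<le> i then D else if j = i - 1 then divisor ds j else 0)" for i j
    using k mn by (auto simp: B1_def col_ops_def B_fun_def D_def)
  have s1: "fun_equiv m n (B_fun ds) B1" unfolding B1_def
  proof (rule fun_equiv_col_ops)
    show "nonneg_fun m n (col_ops {..<?k-1} (n-1) (\<lambda>_. 1) (B_fun ds))"
      unfolding B1_def[symmetric] nonneg_fun_def B1 using D by (auto simp: divisor_def)
    show "nonneg_fun m n (B_fun ds)" by (auto simp: nonneg_fun_def B_fun_def divisor_def)
  qed (use k mn in auto)
  \<comment> \<open>Row \<open>i\<close> with \<open>0 < i < ?k\<close> after the completed row
    \<open>i - 1\<close> has been added to it; the edge needed is the divisor in column
    \<open>i - 1\<close>.\<close>
  define L where "L i j = D + (if j < i then divisor ds j else 0)" for i j :: nat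
  have L_pos: "0 < L i j" for i j using D by (auto simp: L_def divisor_def add_pos_nonneg)
  define B2 where "B2 t i j = (if i \<le> t \<and> i < ?k then L i j else B1 i j)" for t i j :: nat
  have B2_nonneg: "nonneg_fun m n (B2 t)" for t
    unfolding nonneg_fun_def B2_def B1 using L_pos D by (auto simp: divisor_def less_imp_le)
  have s2: "fun_equiv m n B1 (B2 t)" if "t < ?k" for t
    using that
  proof (induction t)
    case 0
    have "B2 0 = B1" by (auto simp: B2_def B1 L_def fun_eq_iff)
    then show ?case by (simp add: fun_equiv_refl)
  next
    case (Suc t)
    have eq: "B2 (Suc t) = row_op (Suc t) t 1 (B2 t)"
      using Suc.prems by (auto simp: B2_def B1 L_def row_op_def fun_eq_iff le_Suc_eq)
    have "fun_equiv m n (B2 t) (B2 (Suc t))"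
      unfolding eq
    proof (rule fun_equiv_row_op)
      show "nonneg_fun m n (row_op (Suc t) t 1 (B2 t))" unfolding eq[symmetric] by (rule B2_nonneg)
      show "0 < B2 t (Suc t) t" using Suc.prems dpos[of t] by (simp add: B2_def B1)
      show "0 < row_op (Suc t) t 1 (B2 t) (Suc t) t"
        unfolding eq[symmetric] using Suc.prems L_pos by (simp add: B2_def)
    qed (use Suc.prems k mn B2_nonneg in auto)
    with Suc show ?case using fun_equiv_trans by auto
  qed
  define B3 where "B3 = B2 (?k - 1)"
  have B3: "B3 i j = D + (if j < i \<and> i < ?k then divisor ds j else 0)" for i j
    using k by (auto simp: B3_def B2_def B1 L_def)
  have s3: "fun_equiv m n B1 B3" unfolding B3_def using k by (intro s2) auto
  have B3_pos: "0 < B3 i j" for i j unfolding B3 using D by (auto simp: divisor_def add_pos_nonneg)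
  \<comment> \<open>Column 0 is \<open>D + d\<close> in rows 1 to \<open>?k - 1\<close> and
    \<open>D\<close> elsewhere. Adding it to the other columns makes row 1 minus row 0 constantly
    \<open>d\<close> and leaves room for the subtractions that follow.\<close>
  define B4 where "B4 = col_ops {1..<n} 0 (\<lambda>_. 1) B3"
  have B4: "B4 i j = (if j = 0 then B3 i 0 else B3 i j + B3 i 0)" if "j < n" for i j
    using that by (auto simp: B4_def col_ops_def)
  have B4_pos: "0 < B4 i j" if "j < n" for i j using B3_pos[of i j] B3_pos[of i 0] B4[OF that] by auto
  have s4: "fun_equiv m n B3 B4" unfolding B4_def
    by (rule fun_equiv_col_ops)
      (use k mn B3_pos in \<open>auto simp: nonneg_fun_def col_ops_def add_pos_pos less_imp_le\<close>)
  define B5 where "B5 = row_op 1 0 (-1) B4"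
  have B5: "B5 i j = (if i = 1 then d else B4 i j)" if "j < n" for i j
    using that k mn by (auto simp: B5_def row_op_def B4 B3 d_def)
  have B5_pos: "0 < B5 i j" if "j < n" for i j using B5[OF that] B4_pos[OF that] d by simp
  have s5: "fun_equiv m n B4 B5" unfolding B5_def
  proof (rule fun_equiv_row_op)
    show "nonneg_fun m n (row_op 1 0 (-1) B4)" "0 < row_op 1 0 (-1) B4 1 0"
      unfolding B5_def[symmetric] nonneg_fun_def using B5_pos mn by (auto simp: less_imp_le)
  qed (use k mn B4_pos in \<open>auto simp: nonneg_fun_def less_imp_le\<close>)
  \<comment> \<open>Chosen so that entries \<open>D\<close> and \<open>D + d\<close> of column 0
    become \<open>d\<close> when \<open>t i\<close> times the constant row 1 is added.\<close>
  define t where "t i = (if i = 0 \<or> ?k \<le> i then 1 - D div d else - (D div d))" for i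
  define T where "T = row_ops ({..<m} - {1}) 1 t B5"
  have td: "t i * d = (if i = 0 \<or> ?k \<le> i then d - D else - D)" for i
    using D(2) by (auto simp: t_def left_diff_distrib)
  have T: "T i j = (if i = 1 then d else B4 i j + (if i = 0 \<or> ?k \<le> i then d - D else - D))" if "i < m" "j < n" for i j
    using that td[of i] by (simp add: T_def row_ops_def B5)
  have T_col: "T i 0 = d" if "i < m" for i
    using that k mn by (auto simp: T B4 B3 d_def)
  have T_pos: "0 < T i j" if "i < m" "j < n" for i j
    using that k mn D d dpos[of j] dpos[of 0] by (cases "j = 0") (auto simp: T_col T B4 B3 d_def)
  have T_dvd: "d dvd T i j" if "i < m" "j < n" for i j
    using that D ddvd[of j] by (auto simp: T B4 B3 d_def[symmetric] intro!: dvd_add)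
  have s6: "fun_equiv m n B5 T" unfolding T_def
  proof (rule fun_equiv_row_ops)
    show "nonneg_fun m n (row_ops ({..<m} - {1}) 1 t B5)"
      unfolding T_def[symmetric] nonneg_fun_def using T_pos by (auto simp: less_imp_le)
    show "0 < row_ops ({..<m} - {1}) 1 t B5 i 1" if "i \<in> {..<m} - {1}" for i
      unfolding T_def[symmetric] using T_pos that k mn by auto
  qed (use k mn B5_pos in \<open>auto simp: nonneg_fun_def less_imp_le\<close>)
  have "fun_equiv m n (B_fun ds) T"
    using s1 s3 s4 s5 s6 fun_equiv_trans by blast
  then show ?thesis using T_col T_pos T_dvd unfolding d_def by blast
qed

section \<open>Comparison of the two matrices through their common elementary divisors\<close>

theorem theorem8p5:
  fixes C :: "nat mat" and n m d :: nat and ds :: "nat list"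
  assumes "C \<in> carrier_mat n n"
    and "m \<le> n" and "m \<noteq> n"
    and "\<forall>i<m. \<forall>j<n. C $$ (i,j) \<noteq> 0"
    and "\<forall>i. m \<le> i \<and> i < n \<longrightarrow> (\<forall>j<n. C $$ (i,j) = 0)"
    and "d = Gcd {C $$ (i,j) | i j. i < n \<and> j < n \<and> C $$ (i,j) \<noteq> 0}"
    and "\<forall>i<n. C $$ (i,0) = (if i < m then d else 0)"
    and "elem_divisors (mat m n (\<lambda>(i,j). int (C $$ (i,j)))) ds"
    and "det (mat m m (\<lambda>(i,j). int (C $$ (i,j)))) = 0"
  shows "mat_move_equiv (J_mat n m + map_mat enat C) (J_mat n m + map_mat enat (B_mat n m ds))"
proof -
  \<comment> \<open>The empty determinant is 1, so a vanishing one excludes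
    \<open>m = 0\<close>.\<close>
  have m: "0 < m"
  proof (rule ccontr)
    assume "\<not> 0 < m"
    then have "det (mat m m (\<lambda>(i,j). int (C $$ (i,j)))) = 1" by (intro det_dim_zero) auto
    then show False using assms(9) by simp
  qed
  have mn: "m < n" using assms(2,3) by simp
  define F where "F i j = int (C $$ (i,j))" for i j
  have d: "0 < int d" using assms(4,7) m mn by (metis gr0I of_nat_0_less_iff order_less_trans)
  have F: "0 < F i j \<and> int d dvd F i j" if "i < m" "j < n" for i j
  proof -
    have "C $$ (i,j) \<in> {C $$ (i,j) | i j. i < n \<and> j < n \<and> C $$ (i,j) \<noteq> 0}"
      using assms(4) that mn by (intro CollectI exI[of _ i] exI[of _ j]) auto
    then have "d dvd C $$ (i,j)" unfolding assms(6) by (rule Gcd_dvd)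
    then show ?thesis using assms(4) that by (simp add: F_def)
  qed
  have F0: "F i 0 = int d" if "i < m" for i using assms(7) that mn by (simp add: F_def)
  have len: "length ds \<le> m" and ds_pos: "\<And>i. i < length ds \<Longrightarrow> 0 < ds ! i"
    and chain: "\<And>i. Suc i < length ds \<Longrightarrow> ds ! i dvd ds ! Suc i"
    using assms(8) by (auto simp: elem_divisors_def)
  obtain P Q where PQ: "P \<in> carrier_mat m m" "Q \<in> carrier_mat n n" "invertible_mat P" "invertible_mat Q"
    "P * fun_mat m n F * Q = mat m n (\<lambda>(i,j). if i = j \<and> i < length ds then int (ds ! i) else 0)"
    using assms(8) by (auto simp: elem_divisors_def fun_mat_def F_def)
  have "mat m n (\<lambda>(i,j). if i = j \<and> i < length ds then int (ds ! i) else 0) = fun_mat m n (diag_fun (divisor ds))"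
    by (intro eq_matI) (auto simp: fun_mat_def diag_fun_def divisor_def)
  then have Fds: "int_equiv m n F (diag_fun (divisor ds))"
    unfolding int_equiv_def using PQ unimodular_if_invertible by metis
  have b: "divisor ds i dvd divisor ds (Suc i)" "0 \<le> divisor ds i" for i
    using chain by (auto simp: divisor_def)
  \<comment> \<open>The first elementary divisor is the entry \<open>d\<close> of the first column,
    so \<open>C\<close> and the matrix \<open>T\<close> obtained from \<open>B\<close> agree in that
    column.\<close>
  have d0: "divisor ds 0 = int d" by (rule normal_form(1)[OF m mn d F F0 Fds b])
  then have k: "0 < length ds" using d by (auto simp: divisor_def split: if_splits)
  have dvd0: "ds ! 0 dvd ds ! i" if "i < length ds" for i
    using that by (induction i) (auto intro: dvd_trans chain Suc_lessD)
  have "\<exists>T. fun_equiv m n (B_fun ds) T \<and> (\<forall>i<m. \<forall>j<n. 0 < T i j \<and> divisor ds 0 dvd T i j) \<and>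
    (\<forall>i<m. T i 0 = divisor ds 0)"
  proof (cases "length ds = 1")
    case True
    \<comment> \<open>With a single divisor, \<open>B\<close> is already constant in its first
      \<open>m\<close> rows.\<close>
    then have "B_fun ds i j = divisor ds 0" for i j by (auto simp: B_fun_def)
    then show ?thesis using d d0 by (intro exI[of _ "B_fun ds"]) (auto intro: fun_equiv_refl)
  next
    case False
    then have "2 \<le> length ds" using k by linarith
    then show ?thesis using len mn ds_pos dvd0 by (intro B_fun_constant_column) auto
  qed
  then obtain T where T: "fun_equiv m n (B_fun ds) T"
    "\<And>i j. i < m \<Longrightarrow> j < n \<Longrightarrow> 0 < T i j \<and> int d dvd T i j" "\<And>i. i < m \<Longrightarrow> T i 0 = int d"
    unfolding d0 by blast
  \<comment> \<open>The moves from \<open>B\<close> to \<open>T\<close> carry along the elementary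
    divisors, computed for \<open>B\<close> itself.\<close>
  have Tds: "int_equiv m n T (diag_fun (divisor ds))"
    using T(1) B_fun_int_equiv[OF k len mn] int_equiv_sym int_equiv_trans unfolding fun_equiv_def by blast
  have "fun_equiv m n F T" by (rule constant_column_equiv[OF m mn d F F0 Fds T(2,3) Tds b])
  then have eq: "fun_equiv m n F (B_fun ds)" using T(1) fun_equiv_sym fun_equiv_trans by blast
  have "graph_of_mat (J_mat n m + map_mat enat C) (mat_graph {..<n} (mat_of_fun m F))"
    using assms(1) by (auto simp: graph_of_mat_def J_mat_def wf_mat_graph ecount_mat_graph mat_of_fun_def F_def add.commute)
  moreover have "graph_of_mat (J_mat n m + map_mat enat (B_mat n m ds)) (mat_graph {..<n} (mat_of_fun m (B_fun ds)))"
    using B_entry_B_fun[OF k len]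
    by (auto simp: graph_of_mat_def J_mat_def B_mat_def wf_mat_graph ecount_mat_graph mat_of_fun_def add.commute
      simp flip: B_entry_B_fun[OF k len])
  ultimately show ?thesis unfolding mat_move_equiv_def using eq by (auto simp: fun_equiv_def)
qed

end
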